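(* Let $\Delta=[-\frac{\pi}{2},\frac{\pi}{2}]$. The space $H^1_0(\Delta)$ equipped with the inner product $\langle\cdot,\cdot\rangle_i$ (and norm $\|f\|_i=\langle f,f\rangle_i^{1/2}$) is a reproducing kernel Hilbert space, i.e. it is complete, all point evaluations $f\mapsto f(x)$, $x\in\Delta$, are bounded linear functionals, and its reproducing kernel is $$K_i(x,y)=2-\frac{\pi}{2}\sin|x-y|,\qquad x,y\in\Delta.$$
   Context: $H^1(\Delta)$ denotes the space of absolutely continuous functions $f:\Delta\to\mathbb{R}$ whose (a.e. defined) derivative $f'$ lies in $L_2(\Delta)$. $H^1_0(\Delta)$ is the subspace of those $f\in H^1(\Delta)$ with $f(-\frac{\pi}{2})=f(\frac{\pi}{2})$. For $f,g\in H^1_0(\Delta)$, $$\langle f,g\rangle_i=\frac{1}{\pi^2}\Big[2\Big(\int_{-\pi/2}^{\pi/2}f\Big)\Big(\int_{-\pi/2}^{\pi/2}g\Big)-\pi\int_{-\pi/2}^{\pi/2}\big(fg-f'g'\big)\Big],$$ which is a positive definite inner product on $H^1_0(\Delta)$. *)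

theory Defs
  imports "HOL-Analysis.Analysis"
begin

definition Delta :: "real set" where
  "Delta = {-(pi/2)..pi/2}"

definition abs_continuous_on :: "real set \<Rightarrow> (real \<Rightarrow> real) \<Rightarrow> bool" where
  "abs_continuous_on S f \<longleftrightarrow>
     (\<forall>e>0. \<exists>d>0. \<forall>(n::nat) (a::nat \<Rightarrow> real) (b::nat \<Rightarrow> real).
        (\<forall>k<n. a k \<in> S \<and> b k \<in> S \<and> a k \<le> b k) \<and>
        (\<forall>k. Suc k < n \<longrightarrow> b k \<le> a (Suc k)) \<and>
        (\<Sum>k<n. b k - a k) < d
        \<longrightarrow> (\<Sum>k<n. \<bar>f (b k) - f (a k)\<bar>) < e)"

definition dDelta :: "(real \<Rightarrow> real) \<Rightarrow> real \<Rightarrow> real" where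
  "dDelta f x = vector_derivative f (at x within Delta)"

definition H1 :: "(real \<Rightarrow> real) set" where
  "H1 = {f. abs_continuous_on Delta f \<and> dDelta f measurable_on Delta \<and>
            (\<lambda>x. (dDelta f x)\<^sup>2) integrable_on Delta}"

definition H10 :: "(real \<Rightarrow> real) set" where
  "H10 = {f \<in> H1. f (-(pi/2)) = f (pi/2)}"

definition inner_i :: "(real \<Rightarrow> real) \<Rightarrow> (real \<Rightarrow> real) \<Rightarrow> real" where
  "inner_i f g = (1 / pi\<^sup>2) *
     (2 * integral Delta f * integral Delta g
      - pi * integral Delta (\<lambda>x. f x * g x - dDelta f x * dDelta g x))"

definition norm_i :: "(real \<Rightarrow> real) \<Rightarrow> real" where
  "norm_i f = sqrt (inner_i f f)"

definition K_i :: "real \<Rightarrow> real \<Rightarrow> real" where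
  "K_i x y = 2 - (pi/2) * sin \<bar>x - y\<bar>"

end

(*
  An absolutely continuous f is the difference of two increasing absolutely continuous functions,
  its variation V and V - f; their Stieltjes measures have Radon-Nikodym densities. Hence f is
  an indefinite integral, and Lebesgue's differentiation theorem yields f' a.e. and the fundamental
  theorem of calculus for f.

  With m the mean of f over Delta and E the integral of f'^2, a Wirtinger inequality gives
  m^2 + E/40 <= <f,f>_i <= m^2 + E on H^1_0, so completeness reduces to that of the reals and of
  L^2(Delta), and point evaluations are bounded because |f - m|^2 <= (pi/12) E. The reproducing
  identity is the fundamental theorem for x |-> cos(x - y) f(x) on each side of y.
*)
theory Submission
  imports Defs
begin

text \<open>Expanding \<open>inner_i f f\<close> around the mean m gives m^2 + (E - S) / pi, where S
  is the integral of (f - m)^2 over Delta. Definiteness is thus not visible and needs S <= c E with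
  some c < 1. On all of H^1 this fails: f = sin has m = 0 and S = E. The condition of equal endpoint
  values is what helps, and c = pi^2/12 arises by integrating the same pointwise bound that later
  controls evaluations.

  The kernel is a Green function: as a function of x it satisfies K'' + K = 2 off x = y, and its
  derivative jumps by -pi there.

  \<open>dDelta\<close> has an unspecified value wherever f is not differentiable. Every identity
  about it is therefore proved off a negligible set and carried into integrals by changing the
  integrand on that set.\<close>

section \<open>Absolute continuity and variation\<close>

text \<open>Families of intervals are finite sets of endpoint pairs, so that they can be cut, united
  and mapped without renumbering, unlike the ordered sequences in \<open>abs_continuous_on\<close>.
  Excluding degenerate intervals makes families that live in separate intervals disjoint as
  sets.\<close>

definition nonoverlapping :: "(real \<times> real) set \<Rightarrow> bool" where
  "nonoverlapping D \<longleftrightarrow> finite D \<and> (\<forall>p\<in>D. fst p < snd p) \<and>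
     (\<forall>p\<in>D. \<forall>q\<in>D. p \<noteq> q \<longrightarrow> snd p \<le> fst q \<or> snd q \<le> fst p)"

definition variation_sum :: "(real \<Rightarrow> real) \<Rightarrow> (real \<times> real) set \<Rightarrow> real" where
  "variation_sum f D = (\<Sum>p\<in>D. \<bar>f (snd p) - f (fst p)\<bar>)"

definition length_sum :: "(real \<times> real) set \<Rightarrow> real" where
  "length_sum D = (\<Sum>p\<in>D. snd p - fst p)"

lemma nonoverlapping_empty [simp]: "nonoverlapping {}"
  by (simp add: nonoverlapping_def)

lemma nonoverlapping_subset: "nonoverlapping D \<Longrightarrow> E \<subseteq> D \<Longrightarrow> nonoverlapping E"
  by (auto simp: nonoverlapping_def subset_eq intro: rev_finite_subset)

lemma nonoverlapping_last:
  assumes "nonoverlapping (insert p D)" "\<And>q. q \<in> D \<Longrightarrow> fst q \<le> fst p" "p \<notin> D" "q \<in> D"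
  shows "snd q \<le> fst p"
proof -
  have "q \<noteq> p" using assms(3,4) by blast
  then have "snd p \<le> fst q \<or> snd q \<le> fst p" "fst p < snd p"
    using assms(1,4) by (auto simp: nonoverlapping_def)
  then show ?thesis using assms(2)[OF assms(4)] by linarith
qed

text \<open>Induction along left endpoints: the pair with the largest one is appended last, and all
  earlier intervals must end before it starts. This is the bridge to the sequences of
  \<open>abs_continuous_on\<close>.\<close>

lemma nonoverlapping_enum:
  assumes "nonoverlapping D"
  shows "\<exists>(n::nat) a b. inj_on (\<lambda>k. (a k, b k)) {..<n} \<and> D = (\<lambda>k. (a k, b k)) ` {..<n} \<and>
           (\<forall>k. Suc k < n \<longrightarrow> b k \<le> a (Suc k))"
proof -
  have "finite D" using assms by (simp add: nonoverlapping_def)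
  then show ?thesis using assms
  proof (induction D rule: finite_ranking_induct[where f = fst])
    case empty
    then show ?case by (intro exI[of _ 0]) auto
  next
    case (insert p S)
    show ?case
    proof (cases "p \<in> S")
      case True
      then show ?thesis using insert.IH insert.prems by (simp add: insert_absorb)
    next
      case notin: False
      obtain n a b where IH: "inj_on (\<lambda>k. (a k, b k)) {..<n::nat}" "S = (\<lambda>k. (a k, b k)) ` {..<n}"
        "\<forall>k. Suc k < n \<longrightarrow> b k \<le> a (Suc k)"
        using insert nonoverlapping_subset by (metis subset_insertI)
      have last: "b k \<le> fst p" if "k < n" for k
        using nonoverlapping_last[OF insert.prems insert.hyps(2) notin, of "(a k, b k)"] that IH(2)
        by force
      let ?a = "a(n := fst p)" and ?b = "b(n := snd p)"
      have eq: "(\<lambda>k. (?a k, ?b k)) ` {..<Suc n} = insert p S"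
        unfolding lessThan_Suc image_insert IH(2) by (auto simp: image_def)
      have "inj_on (\<lambda>k. (?a k, ?b k)) {..<Suc n}"
        using IH notin
        unfolding lessThan_Suc inj_on_insert by (auto simp: inj_on_def)
      moreover have "\<forall>k. Suc k < Suc n \<longrightarrow> ?b k \<le> ?a (Suc k)"
        using IH(3) last by (auto simp: less_Suc_eq)
      ultimately show ?thesis
        by (intro exI[of _ "Suc n"] exI[of _ ?a] exI[of _ ?b] conjI eq[symmetric])
    qed
  qed
qed

definition ac_families :: "(real \<Rightarrow> real) \<Rightarrow> bool" where
  "ac_families f \<longleftrightarrow> (\<forall>e>0. \<exists>d>0. \<forall>D. nonoverlapping D \<longrightarrow> length_sum D < d \<longrightarrow> variation_sum f D < e)"

lemma abs_continuous_imp_ac_families: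
  assumes "abs_continuous_on UNIV f"
  shows "ac_families f"
  unfolding ac_families_def
proof (intro allI impI)
  fix e::real assume "e > 0"
  from assms[unfolded abs_continuous_on_def, rule_format, OF this]
  obtain d where "d > 0" and d: "\<forall>(n::nat) a b. (\<forall>k<n. a k \<in> UNIV \<and> b k \<in> UNIV \<and> a k \<le> b k) \<and>
        (\<forall>k. Suc k < n \<longrightarrow> b k \<le> a (Suc k)) \<and> (\<Sum>k<n. b k - a k) < d \<longrightarrow>
        (\<Sum>k<n. \<bar>f (b k) - f (a k)\<bar>) < e"
    by auto
  have "variation_sum f D < e" if D: "nonoverlapping D" and l: "length_sum D < d" for D
  proof -
    obtain n a b where *: "inj_on (\<lambda>k. (a k, b k)) {..<n::nat}" "D = (\<lambda>k. (a k, b k)) ` {..<n}"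
      "\<forall>k. Suc k < n \<longrightarrow> b k \<le> a (Suc k)"
      using nonoverlapping_enum[OF D] by metis
    have "\<forall>k<n. a k \<le> b k"
      using D *(2) unfolding nonoverlapping_def by force
    then show ?thesis
      using d[rule_format, of n a b] l * by (simp add: variation_sum_def length_sum_def sum.reindex)
  qed
  then show "\<exists>d>0. \<forall>D. nonoverlapping D \<longrightarrow> length_sum D < d \<longrightarrow> variation_sum f D < e"
    using \<open>d > 0\<close> by blast
qed

text \<open>Clamping extends f to the whole line, where Stieltjes measures live, and makes it
  constant to the left of \<open>a\<close>, as \<open>ac_families_jordan\<close> requires. It
  preserves order and never lengthens an interval; intervals that it collapses are harmless because
  \<open>abs_continuous_on\<close> admits equal endpoints.\<close>

lemma abs_continuous_on_clamp:
  assumes "abs_continuous_on {a..b} f" "a \<le> b"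
  shows "abs_continuous_on UNIV (\<lambda>x. f (max a (min b x)))"
  unfolding abs_continuous_on_def
proof (intro allI impI)
  fix e::real assume "e > 0"
  from assms(1)[unfolded abs_continuous_on_def, rule_format, OF this]
  obtain d where "d > 0" and d: "\<forall>(n::nat) u v. (\<forall>k<n. u k \<in> {a..b} \<and> v k \<in> {a..b} \<and> u k \<le> v k) \<and>
        (\<forall>k. Suc k < n \<longrightarrow> v k \<le> u (Suc k)) \<and> (\<Sum>k<n. v k - u k) < d \<longrightarrow>
        (\<Sum>k<n. \<bar>f (v k) - f (u k)\<bar>) < e"
    by auto
  let ?c = "\<lambda>x. max a (min b x)"
  have c_mono: "?c x \<le> ?c y" if "x \<le> y" for x y
    using that by (intro max.mono min.mono order.refl)
  show "\<exists>d>0. \<forall>(n::nat) u v. (\<forall>k<n. u k \<in> UNIV \<and> v k \<in> UNIV \<and> u k \<le> v k) \<and>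
        (\<forall>k. Suc k < n \<longrightarrow> v k \<le> u (Suc k)) \<and> (\<Sum>k<n. v k - u k) < d \<longrightarrow>
        (\<Sum>k<n. \<bar>f (?c (v k)) - f (?c (u k))\<bar>) < e"
  proof (intro exI[of _ d] conjI allI impI \<open>d > 0\<close>)
    fix n :: nat and u v :: "nat \<Rightarrow> real"
    assume uv: "(\<forall>k<n. u k \<in> UNIV \<and> v k \<in> UNIV \<and> u k \<le> v k) \<and>
        (\<forall>k. Suc k < n \<longrightarrow> v k \<le> u (Suc k)) \<and> (\<Sum>k<n. v k - u k) < d"
    have "(\<Sum>k<n. ?c (v k) - ?c (u k)) \<le> (\<Sum>k<n. v k - u k)"
      using uv by (intro sum_mono) (auto simp: max_def min_def)
    moreover have "\<forall>k<n. ?c (u k) \<in> {a..b} \<and> ?c (v k) \<in> {a..b} \<and> ?c (u k) \<le> ?c (v k)"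
      using uv c_mono assms(2) by auto
    moreover have "\<forall>k. Suc k < n \<longrightarrow> ?c (v k) \<le> ?c (u (Suc k))"
      using uv c_mono by blast
    moreover have "(\<Sum>k<n. ?c (v k) - ?c (u k)) < d" using calculation(1) uv by linarith
    ultimately show "(\<Sum>k<n. \<bar>f (?c (v k)) - f (?c (u k))\<bar>) < e"
      using d[rule_format, of n "\<lambda>k. ?c (u k)" "\<lambda>k. ?c (v k)"] by blast
  qed
qed

section \<open>Total variation and the Jordan decomposition\<close>

definition family_in :: "real \<Rightarrow> real \<Rightarrow> (real \<times> real) set \<Rightarrow> bool" where
  "family_in x y D \<longleftrightarrow> nonoverlapping D \<and> (\<forall>p\<in>D. x \<le> fst p \<and> snd p \<le> y)"

lemma family_in_empty [simp]: "family_in x y {}"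
  by (simp add: family_in_def)

text \<open>Remove the rightmost interval: the others fit between \<open>x\<close> and its left
  endpoint. The right bound \<open>y\<close> therefore varies in the induction.\<close>

lemma length_sum_le:
  assumes "family_in x y D" "x \<le> y"
  shows "length_sum D \<le> y - x"
proof -
  have "finite D" using assms by (simp add: nonoverlapping_def family_in_def)
  then show ?thesis using assms
  proof (induction D arbitrary: y rule: finite_ranking_induct[where f = fst])
    case empty
    then show ?case by (simp add: length_sum_def)
  next
    case (insert p S)
    show ?case
    proof (cases "p \<in> S")
      case True
      then show ?thesis using insert.IH insert.prems by (simp add: insert_absorb)
    next
      case notin: False
      have no: "nonoverlapping (insert p S)" and p: "x \<le> fst p" "fst p < snd p" "snd p \<le> y"
        using insert.prems by (auto simp: family_in_def nonoverlapping_def)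
      have "length_sum S \<le> fst p - x"
      proof (rule insert.IH)
        show "family_in x (fst p) S"
          using insert.prems nonoverlapping_last[OF no insert.hyps(2) notin] nonoverlapping_subset[OF no]
          by (auto simp: family_in_def)
      qed (use p in auto)
      then show ?thesis
        using insert.hyps notin p by (simp add: length_sum_def)
    qed
  qed
qed

text \<open>Intervals straddling \<open>z\<close> are cut there, and all others go unchanged to one
  side. By the triangle inequality a cut can only increase the variation.\<close>

lemma family_in_split:
  assumes "family_in x y D"
  obtains D1 D2 where "family_in x z D1" "family_in z y D2"
    "variation_sum f D \<le> variation_sum f D1 + variation_sum f D2"
proof -
  let ?l = "\<lambda>p. (fst p, min (snd p) z)" and ?r = "\<lambda>p. (max (fst p) z, snd p)"
  let ?A = "{p\<in>D. fst p < z}" and ?B = "{p\<in>D. z < snd p}"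
  have fin: "finite D" and lt: "\<And>p. p \<in> D \<Longrightarrow> fst p < snd p"
    and no: "\<And>p q. p \<in> D \<Longrightarrow> q \<in> D \<Longrightarrow> p \<noteq> q \<Longrightarrow> snd p \<le> fst q \<or> snd q \<le> fst p"
    and bd: "\<And>p. p \<in> D \<Longrightarrow> x \<le> fst p \<and> snd p \<le> y"
    using assms by (auto simp: family_in_def nonoverlapping_def)
  \<comment> \<open>Truncation could identify two pairs with a common left endpoint, but those
    intervals would overlap.\<close>
  have injA: "inj_on ?l ?A"
  proof (rule inj_onI, rule ccontr)
    fix p q assume "p \<in> ?A" "q \<in> ?A" "?l p = ?l q" "p \<noteq> q"
    then show False using no[of p q] lt[of p] lt[of q] by auto
  qed
  have injB: "inj_on ?r ?B"
  proof (rule inj_onI, rule ccontr)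
    fix p q assume "p \<in> ?B" "q \<in> ?B" "?r p = ?r q" "p \<noteq> q"
    then show False using no[of p q] lt[of p] lt[of q] by auto
  qed
  have sepA: "snd p \<le> fst q \<or> snd q \<le> fst p" if pq: "p \<in> ?l ` ?A" "q \<in> ?l ` ?A" "p \<noteq> q" for p q
  proof -
    obtain p' q' where "p' \<in> D" "q' \<in> D" "p = ?l p'" "q = ?l q'" using pq(1,2) by blast
    moreover from this have "snd p' \<le> fst q' \<or> snd q' \<le> fst p'" using no pq(3) by blast
    ultimately show ?thesis by (auto simp: min_le_iff_disj le_max_iff_disj)
  qed
  have "family_in x z (?l ` ?A)"
    unfolding family_in_def nonoverlapping_def
  proof (intro conjI)
    show "\<forall>p\<in>?l ` ?A. \<forall>q\<in>?l ` ?A. p \<noteq> q \<longrightarrow> snd p \<le> fst q \<or> snd q \<le> fst p"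
      using sepA by blast
  qed (use fin bd lt in simp_all)
  moreover have sepB: "snd p \<le> fst q \<or> snd q \<le> fst p" if pq: "p \<in> ?r ` ?B" "q \<in> ?r ` ?B" "p \<noteq> q" for p q
  proof -
    obtain p' q' where "p' \<in> D" "q' \<in> D" "p = ?r p'" "q = ?r q'" using pq(1,2) by blast
    moreover from this have "snd p' \<le> fst q' \<or> snd q' \<le> fst p'" using no pq(3) by blast
    ultimately show ?thesis by (auto simp: min_le_iff_disj le_max_iff_disj)
  qed
  have "family_in z y (?r ` ?B)"
    unfolding family_in_def nonoverlapping_def
  proof (intro conjI)
    show "\<forall>p\<in>?r ` ?B. \<forall>q\<in>?r ` ?B. p \<noteq> q \<longrightarrow> snd p \<le> fst q \<or> snd q \<le> fst p"
      using sepB by blast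
  qed (use fin bd lt in simp_all)
  moreover have "variation_sum f D \<le> variation_sum f (?l ` ?A) + variation_sum f (?r ` ?B)"
  proof -
    have "variation_sum f D \<le> (\<Sum>p\<in>D. (if fst p < z then \<bar>f (min (snd p) z) - f (fst p)\<bar> else 0)
            + (if z < snd p then \<bar>f (snd p) - f (max (fst p) z)\<bar> else 0))"
      unfolding variation_sum_def
    proof (rule sum_mono)
      fix p assume "p \<in> D"
      then show "\<bar>f (snd p) - f (fst p)\<bar> \<le> (if fst p < z then \<bar>f (min (snd p) z) - f (fst p)\<bar> else 0)
            + (if z < snd p then \<bar>f (snd p) - f (max (fst p) z)\<bar> else 0)"
      proof -
        consider "snd p \<le> z" | "z \<le> fst p" | "fst p < z" "z < snd p" by linarith
        then show ?thesis using lt[OF \<open>p \<in> D\<close>] by cases simp_all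
      qed
    qed
    also have "\<dots> = variation_sum f (?l ` ?A) + variation_sum f (?r ` ?B)"
      unfolding variation_sum_def sum.reindex[OF injA] sum.reindex[OF injB] sum.distrib o_def
      using fin by (simp add: sum.inter_filter)
    finally show ?thesis .
  qed
  ultimately show thesis using that by blast
qed

definition variation :: "(real \<Rightarrow> real) \<Rightarrow> real \<Rightarrow> real \<Rightarrow> real" where
  "variation f a x = (SUP D\<in>{D. family_in a x D}. variation_sum f D)"

text \<open>Chop the range into steps of length d/2. A family inside one step has total length below
  d, hence variation below 1, so n steps contribute at most n. Half of d is taken because the
  condition on the length is strict.\<close>

lemma ac_families_bounded_variation:
  assumes "ac_families f"
  shows "\<exists>C. \<forall>D. family_in a x D \<longrightarrow> variation_sum f D \<le> C"
proof -
  obtain d where "d > 0" and d: "\<And>D. nonoverlapping D \<Longrightarrow> length_sum D < d \<Longrightarrow> variation_sum f D < 1"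
    using assms unfolding ac_families_def by (metis zero_less_one)
  have *: "variation_sum f D \<le> n" if "family_in a (a + n * (d/2)) D" for n :: nat and D
    using that
  proof (induction n arbitrary: D)
    case 0
    then have "D = {}" by (force simp: family_in_def nonoverlapping_def)
    then show ?case by (simp add: variation_sum_def)
  next
    case (Suc n)
    obtain D1 D2 where s: "family_in a (a + n * (d/2)) D1" "family_in (a + n * (d/2)) (a + Suc n * (d/2)) D2"
      "variation_sum f D \<le> variation_sum f D1 + variation_sum f D2"
      using family_in_split[OF Suc.prems] by metis
    have "length_sum D2 \<le> (a + Suc n * (d/2)) - (a + n * (d/2))"
      using \<open>d > 0\<close> by (intro length_sum_le[OF s(2)]) (simp add: algebra_simps)
    then have "length_sum D2 < d" using \<open>d > 0\<close> by (simp add: algebra_simps)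
    then have "variation_sum f D2 < 1" using d s(2) by (auto simp: family_in_def)
    then show ?case using Suc.IH[OF s(1)] s(3) by simp
  qed
  obtain n :: nat where "(x - a) / (d/2) \<le> n" using real_arch_simple by blast
  then have "x \<le> a + n * (d/2)" using \<open>d > 0\<close> by (simp add: field_simps)
  then have "family_in a (a + n * (d/2)) D" if "family_in a x D" for D
    using that by (force simp: family_in_def)
  then show ?thesis using * by blast
qed

lemma variation_upper:
  assumes "ac_families f" "family_in a x D"
  shows "variation_sum f D \<le> variation f a x"
  unfolding variation_def
proof (rule cSUP_upper)
  show "bdd_above (variation_sum f ` {D. family_in a x D})"
    using ac_families_bounded_variation[OF assms(1), of a x] by (auto intro: bdd_aboveI2)
qed (use assms(2) in simp)

lemma variation_least:
  assumes "\<And>D. family_in a x D \<Longrightarrow> variation_sum f D \<le> C"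
  shows "variation f a x \<le> C"
  unfolding variation_def by (rule cSUP_least) (use assms in \<open>auto intro: exI[of _ "{}"]\<close>)

text \<open>The subadditive half of the additivity of variation. With an arbitrary bound
  \<open>C\<close> it can be read backwards: if no family between \<open>u\<close> and
  \<open>v\<close> came close to the increment of the variation, that increment would be smaller
  than itself.\<close>

lemma variation_le_split:
  assumes "ac_families f" "\<And>D. family_in u v D \<Longrightarrow> variation_sum f D \<le> C"
  shows "variation f a v \<le> variation f a u + C"
proof (rule variation_least)
  fix D assume "family_in a v D"
  then obtain D1 D2 where "family_in a u D1" "family_in u v D2"
    "variation_sum f D \<le> variation_sum f D1 + variation_sum f D2"
    using family_in_split by metis
  then show "variation_sum f D \<le> variation f a u + C"
    using variation_upper[OF assms(1), of a u D1] assms(2)[of D2] by linarith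
qed

text \<open>Appending the single interval from \<open>x\<close> to \<open>y\<close> to a family
  ending at \<open>x\<close> gains exactly the increment of f. This makes the difference of the
  variation and f increasing from \<open>a\<close> on.\<close>

lemma variation_increment:
  assumes "ac_families f" "a \<le> x" "x < y"
  shows "variation f a x + \<bar>f y - f x\<bar> \<le> variation f a y"
proof -
  have "variation f a x \<le> variation f a y - \<bar>f y - f x\<bar>"
  proof (rule variation_least)
    fix D assume D: "family_in a x D"
    then have "(x, y) \<notin> D" and "finite D"
      using \<open>x < y\<close> by (force simp: family_in_def nonoverlapping_def)+
    moreover have "family_in a y (insert (x, y) D)"
      using D assms unfolding family_in_def nonoverlapping_def by force
    from variation_upper[OF assms(1) this]
    show "variation_sum f D \<le> variation f a y - \<bar>f y - f x\<bar>"
      using calculation by (simp add: variation_sum_def)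
  qed
  then show ?thesis by simp
qed

lemma mono_variation:
  assumes "ac_families f"
  shows "mono (variation f a)"
proof (rule monoI)
  fix x y :: real assume "x \<le> y"
  then show "variation f a x \<le> variation f a y"
    by (intro variation_least variation_upper[OF assms]) (force simp: family_in_def)
qed

text \<open>Inside each interval of D choose a family that almost attains the increment of the
  variation. The union of these families is nonoverlapping and no longer than D, so absolute
  continuity of f applies to it.\<close>

lemma ac_families_variation:
  assumes f: "ac_families f"
  shows "ac_families (variation f a)"
  unfolding ac_families_def
proof (intro allI impI)
  fix e::real assume "e > 0"
  then obtain d where "d > 0" and d: "\<And>D. nonoverlapping D \<Longrightarrow> length_sum D < d \<Longrightarrow> variation_sum f D < e/2"
    using f unfolding ac_families_def by (metis half_gt_zero)
  have "variation_sum (variation f a) D < e" if D: "nonoverlapping D" and l: "length_sum D < d" for D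
  proof -
    \<comment> \<open>The errors of all intervals together amount to at most e/2; the summand 1
      keeps the denominator positive when D is empty.\<close>
    define \<eta> where "\<eta> = e / (2 * (real (card D) + 1))"
    have "\<eta> > 0" using \<open>e > 0\<close> by (simp add: \<eta>_def)
    have "\<exists>C. family_in (fst p) (snd p) C \<and> variation f a (snd p) - variation f a (fst p) - \<eta> < variation_sum f C" for p
    proof (rule ccontr)
      assume "\<nexists>C. family_in (fst p) (snd p) C \<and> variation f a (snd p) - variation f a (fst p) - \<eta> < variation_sum f C"
      then have "variation f a (snd p) \<le> variation f a (fst p) + (variation f a (snd p) - variation f a (fst p) - \<eta>)"
        by (intro variation_le_split[OF f]) force
      then show False using \<open>\<eta> > 0\<close> by simp
    qed
    then obtain C where C: "\<And>p. family_in (fst p) (snd p) (C p)"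
      "\<And>p. variation f a (snd p) - variation f a (fst p) - \<eta> < variation_sum f (C p)" by metis
    have fin: "finite D" "\<And>p. finite (C p)"
      using D C(1) by (auto simp: family_in_def nonoverlapping_def)
    have C_in: "fst p \<le> fst q" "fst q < snd q" "snd q \<le> snd p" if "q \<in> C p" for p q
      using C(1)[of p] that by (auto simp: family_in_def nonoverlapping_def)
    have sep: "snd p \<le> fst q \<or> snd q \<le> fst p" if "p \<in> D" "q \<in> D" "p \<noteq> q" for p q
      using D that by (auto simp: nonoverlapping_def)
    have disj: "C p \<inter> C q = {}" if pq: "p \<in> D" "q \<in> D" "p \<noteq> q" for p q
    proof -
      have False if "r \<in> C p" "r \<in> C q" for r
        using C_in[OF that(1)] C_in[OF that(2)] sep[OF pq] by linarith
      then show ?thesis by blast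
    qed
    have "nonoverlapping (\<Union>p\<in>D. C p)"
      unfolding nonoverlapping_def
    proof (intro conjI ballI impI)
      fix p q assume "p \<in> (\<Union>p\<in>D. C p)" "q \<in> (\<Union>p\<in>D. C p)" "p \<noteq> q"
      then obtain p' q' where *: "p' \<in> D" "q' \<in> D" "p \<in> C p'" "q \<in> C q'" by auto
      show "snd p \<le> fst q \<or> snd q \<le> fst p"
      proof (cases "p' = q'")
        case True
        then show ?thesis using C(1)[of p'] * \<open>p \<noteq> q\<close> by (auto simp: family_in_def nonoverlapping_def)
      next
        case False
        then show ?thesis using sep[OF *(1,2)] C_in[OF *(3)] C_in[OF *(4)] by linarith
      qed
    qed (use fin C_in in auto)
    moreover have "length_sum (\<Union>p\<in>D. C p) < d"
    proof -
      have "length_sum (\<Union>p\<in>D. C p) = (\<Sum>p\<in>D. length_sum (C p))"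
        unfolding length_sum_def using fin disj by (subst sum.UNION_disjoint) auto
      also have "\<dots> \<le> length_sum D"
        unfolding length_sum_def[of D]
        using D by (intro sum_mono length_sum_le[OF C(1)]) (auto simp: nonoverlapping_def less_imp_le)
      finally show ?thesis using l by simp
    qed
    ultimately have "variation_sum f (\<Union>p\<in>D. C p) < e/2" by (rule d)
    moreover have "variation_sum f (\<Union>p\<in>D. C p) = (\<Sum>p\<in>D. variation_sum f (C p))"
      unfolding variation_sum_def using fin disj by (subst sum.UNION_disjoint) auto
    moreover have "variation_sum (variation f a) D \<le> (\<Sum>p\<in>D. variation_sum f (C p) + \<eta>)"
      unfolding variation_sum_def[of "variation f a"]
    proof (rule sum_mono)
      fix p assume "p \<in> D"
      then have "variation f a (fst p) \<le> variation f a (snd p)"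
        using D by (intro monoD[OF mono_variation[OF f]]) (auto simp: nonoverlapping_def less_imp_le)
      then show "\<bar>variation f a (snd p) - variation f a (fst p)\<bar> \<le> variation_sum f (C p) + \<eta>"
        using C(2)[of p] by linarith
    qed
    moreover have "(\<Sum>p\<in>D. variation_sum f (C p) + \<eta>) = (\<Sum>p\<in>D. variation_sum f (C p)) + card D * \<eta>"
      by (simp add: sum.distrib)
    moreover have "card D * \<eta> \<le> e/2"
      using \<open>e > 0\<close> by (simp add: \<eta>_def field_simps)
    ultimately show ?thesis by linarith
  qed
  then show "\<exists>d>0. \<forall>D. nonoverlapping D \<longrightarrow> length_sum D < d \<longrightarrow> variation_sum (variation f a) D < e"
    using \<open>d > 0\<close> by blast
qed

lemma ac_families_diff:
  assumes "ac_families f" "ac_families g"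
  shows "ac_families (\<lambda>x. f x - g x)"
  unfolding ac_families_def
proof (intro allI impI)
  fix e::real assume "e > 0"
  then obtain d d' where "d > 0" "d' > 0"
    and d: "\<And>D. nonoverlapping D \<Longrightarrow> length_sum D < d \<Longrightarrow> variation_sum f D < e/2"
    and d': "\<And>D. nonoverlapping D \<Longrightarrow> length_sum D < d' \<Longrightarrow> variation_sum g D < e/2"
    using assms unfolding ac_families_def by (metis half_gt_zero)
  have le: "variation_sum (\<lambda>x. f x - g x) D \<le> variation_sum f D + variation_sum g D" for D
    unfolding variation_sum_def sum.distrib[symmetric] by (rule sum_mono) linarith
  have "variation_sum (\<lambda>x. f x - g x) D < e" if "nonoverlapping D" "length_sum D < min d d'" for D
    using le[of D] d[of D] d'[of D] that by simp
  then show "\<exists>d>0. \<forall>D. nonoverlapping D \<longrightarrow> length_sum D < d \<longrightarrow> variation_sum (\<lambda>x. f x - g x) D < e"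
    using \<open>d > 0\<close> \<open>d' > 0\<close> by (intro exI[of _ "min d d'"]) simp
qed

lemma ac_families_continuous:
  assumes "ac_families f"
  shows "continuous_on UNIV f"
  unfolding continuous_on_iff
proof (intro ballI allI impI)
  fix x e :: real assume "e > 0"
  then obtain d where "d > 0" and d: "\<And>D. nonoverlapping D \<Longrightarrow> length_sum D < d \<Longrightarrow> variation_sum f D < e"
    using assms unfolding ac_families_def by metis
  have "dist (f y) (f x) < e" if "dist y x < d" for y
    using d[of "{(x, y)}"] d[of "{(y, x)}"] that \<open>e > 0\<close>
    by (cases x y rule: linorder_cases)
       (auto simp: nonoverlapping_def length_sum_def variation_sum_def dist_real_def)
  then show "\<exists>d>0. \<forall>x'\<in>UNIV. dist x' x < d \<longrightarrow> dist (f x') (f x) < e"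
    using \<open>d > 0\<close> by blast
qed

text \<open>The variation is measured from \<open>a\<close>, so it says nothing about increments of
  f further left; constancy of f there fills the gap. An interval containing \<open>a\<close> in its
  interior is handled by passing through \<open>a\<close>.\<close>

lemma ac_families_jordan:
  assumes "ac_families f" "\<And>x. x \<le> a \<Longrightarrow> f x = f a"
  obtains g h where "ac_families g" "ac_families h" "mono g" "mono h" "\<And>x. f x = g x - h x"
proof
  let ?V = "variation f a"
  show "ac_families ?V" "mono ?V"
    using ac_families_variation mono_variation assms by auto
  show "ac_families (\<lambda>x. ?V x - f x)"
    using ac_families_diff ac_families_variation assms by auto
  show "mono (\<lambda>x. ?V x - f x)"
  proof (rule monoI)
    fix x y :: real assume "x \<le> y"
    consider "x = y" | "y \<le> a" | "a \<le> x" "x < y" | "x < a" "a < y" using \<open>x \<le> y\<close> by linarith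
    then show "?V x - f x \<le> ?V y - f y"
    proof cases
      case 2
      then show ?thesis using monoD[OF mono_variation[OF assms(1)] \<open>x \<le> y\<close>, of a] assms(2)[of x] assms(2)[of y] \<open>x \<le> y\<close> by simp
    next
      case 3
      then show ?thesis using variation_increment[OF assms(1) 3] by linarith
    next
      case 4
      then show ?thesis using variation_increment[OF assms(1) order.refl 4(2)]
        monoD[OF mono_variation[OF assms(1)], of x a a] assms(2)[of x] by simp
    qed simp
  qed
qed simp

section \<open>Densities of absolutely continuous functions\<close>

lemma length_sum_less:
  assumes D: "nonoverlapping D" and U: "U \<in> sets borel" "\<And>p. p \<in> D \<Longrightarrow> {fst p<..<snd p} \<subseteq> U"
    and "emeasure lborel U < ennreal d"
  shows "length_sum D < d"
proof -
  have fin: "finite D" and lt: "\<And>p. p \<in> D \<Longrightarrow> fst p < snd p"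
    using D by (auto simp: nonoverlapping_def)
  have "disjoint_family_on (\<lambda>p. {fst p<..<snd p}) D"
    unfolding disjoint_family_on_def
  proof (intro ballI impI)
    fix p q assume "p \<in> D" "q \<in> D" "p \<noteq> q"
    then have "snd p \<le> fst q \<or> snd q \<le> fst p" using D by (auto simp: nonoverlapping_def)
    then show "{fst p<..<snd p} \<inter> {fst q<..<snd q} = {}" by auto
  qed
  then have "(\<Sum>p\<in>D. emeasure lborel {fst p<..<snd p}) = emeasure lborel (\<Union>p\<in>D. {fst p<..<snd p})"
    using fin by (intro sum_emeasure) auto
  also have "\<dots> \<le> emeasure lborel U"
    using U by (intro emeasure_mono) auto
  also have "\<dots> < ennreal d" by fact
  also have "(\<Sum>p\<in>D. emeasure lborel {fst p<..<snd p}) = (\<Sum>p\<in>D. ennreal (snd p - fst p))"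
    using lt by (intro sum.cong) (auto simp: less_imp_le)
  also have "\<dots> = ennreal (length_sum D)"
    unfolding length_sum_def using lt by (intro sum_ennreal) (auto simp: less_imp_le)
  finally have "ennreal (length_sum D) < ennreal d" .
  moreover have "0 \<le> length_sum D"
    unfolding length_sum_def using lt by (intro sum_nonneg) (auto simp: less_imp_le)
  ultimately show ?thesis by (simp add: ennreal_less_iff)
qed

text \<open>
  A null set is covered by nonoverlapping intervals that stay inside an open set of small measure,
  so that absolute continuity bounds the increments of F over any finitely many of them.
\<close>

lemma interval_measure_null:
  assumes F: "mono F" "ac_families F" and N: "N \<in> null_sets lborel"
  shows "N \<in> null_sets (interval_measure F)"
proof -
  let ?\<mu> = "interval_measure F"
  have cont: "continuous_on UNIV F" by (rule ac_families_continuous[OF F(2)])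
  have Icc: "emeasure ?\<mu> {c..d} = ennreal (F d - F c)" if "c \<le> d" for c d
    using that monoD[OF F(1)] cont by (intro emeasure_interval_measure_Icc) auto
  have meas: "N \<in> sets borel" and null: "emeasure lborel N = 0"
    using N by (auto simp: null_sets_def)
  \<comment> \<open>The covering lemma works inside a box, so N is treated one bounded window at a
    time.\<close>
  have small: "emeasure ?\<mu> (N \<inter> {- r..r}) \<le> ennreal e" if "r > 0" "e > 0" for r e :: real
  proof -
    obtain d where "d > 0" and d: "\<And>D. nonoverlapping D \<Longrightarrow> length_sum D < d \<Longrightarrow> variation_sum F D < e"
      using F(2) \<open>e > 0\<close> unfolding ac_families_def by metis
    obtain U where U: "open U" "N \<subseteq> U" "emeasure lborel (U - N) < ennreal d"
      using outer_regular_lborel[OF meas \<open>d > 0\<close>] by metis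
    have "emeasure lborel U = emeasure lborel ((U - N) \<union> N)"
      using U(2) by (simp add: Un_absorb2)
    also have "\<dots> = emeasure lborel (U - N)"
      using N U(1) meas by (intro emeasure_Un_null_set) auto
    finally have mU: "emeasure lborel U < ennreal d" using U(3) by simp
    \<comment> \<open>This gauge forces every cell into U, because each cell is subordinate to a
      point of N and N lies in U; the value off U is arbitrary.\<close>
    define g where "g = (\<lambda>x. if x \<in> U then U else UNIV)"
    have "gauge g" using U(1) by (auto simp: gauge_def g_def)
    moreover have "N \<inter> {-r..r} \<subseteq> cbox (-r) r" "box (-r) r \<noteq> {}" using \<open>r > 0\<close> by auto
    ultimately obtain \<D> where \<D>: "countable \<D>"
      "\<And>K. K \<in> \<D> \<Longrightarrow> interior K \<noteq> {} \<and> (\<exists>c d. K = cbox c d)"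
      "pairwise (\<lambda>A B. interior A \<inter> interior B = {}) \<D>"
      "\<And>K. K \<in> \<D> \<Longrightarrow> \<exists>x \<in> (N \<inter> {-r..r}) \<inter> K. K \<subseteq> g x"
      "N \<inter> {-r..r} \<subseteq> \<Union>\<D>"
      using covering_lemma[of "N \<inter> {-r..r}" "-r" r g] by metis
    have K: "K = {Inf K..Sup K} \<and> Inf K < Sup K \<and> K \<subseteq> U" if KD: "K \<in> \<D>" for K
    proof -
      obtain c d where "K = {c..d}" "interior K \<noteq> {}" using \<D>(2)[OF KD] by (auto simp: cbox_interval)
      moreover from this have "c < d" by auto
      moreover have "K \<subseteq> U" using \<D>(4)[OF KD] U(2) by (auto simp: g_def split: if_splits)
      ultimately show ?thesis by simp
    qed
    \<comment> \<open>Absolute continuity speaks of finite families only. A bound uniform over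
      finite subfamilies passes to the countable union by
      \<open>measure_Union_bound\<close>.\<close>
    have bound: "measure ?\<mu> (\<Union>E) \<le> e" if E: "E \<subseteq> \<D>" "finite E" for E
    proof -
      let ?D = "(\<lambda>K. (Inf K, Sup K)) ` E"
      have inj: "inj_on (\<lambda>K. (Inf K, Sup K)) E"
        using K E(1) by (intro inj_onI) (metis prod.inject subsetD)
      have "nonoverlapping ?D"
        unfolding nonoverlapping_def
      proof (intro conjI ballI impI)
        fix p q assume "p \<in> ?D" "q \<in> ?D" "p \<noteq> q"
        then obtain A B where AB: "A \<in> E" "B \<in> E" "p = (Inf A, Sup A)" "q = (Inf B, Sup B)" "A \<noteq> B" by blast
        then have "interior A \<inter> interior B = {}"
          using \<D>(3) E(1) by (auto simp: pairwise_def)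
        moreover have "interior A = {fst p<..<snd p}" "interior B = {fst q<..<snd q}"
          using K[of A] K[of B] AB E(1) by (metis interior_atLeastAtMost_real fst_conv snd_conv subsetD)+
        moreover have "fst p < snd p" "fst q < snd q" using K AB E(1) by auto
        ultimately show "snd p \<le> fst q \<or> snd q \<le> fst p"
          by (auto simp: max_def min_def not_le split: if_splits)
      qed (use E K in auto)
      moreover have "length_sum ?D < d"
        by (rule length_sum_less[OF calculation borel_open[OF U(1)] _ mU]) (use K E(1) in fastforce)
      ultimately have v: "variation_sum F ?D < e" by (rule d)
      have "measure ?\<mu> (\<Union>E) \<le> (\<Sum>K\<in>E. measure ?\<mu> K)"
      proof -
        have "measure ?\<mu> (\<Union>K\<in>E. K) \<le> (\<Sum>K\<in>E. measure ?\<mu> K)"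
          by (rule measure_UNION_le[OF E(2)]) (use K E(1) in \<open>metis atLeastAtMost_borel sets_interval_measure subsetD\<close>)
        then show ?thesis by simp
      qed
      also have "\<dots> = (\<Sum>K\<in>E. \<bar>F (Sup K) - F (Inf K)\<bar>)"
      proof (rule sum.cong)
        fix K assume "K \<in> E"
        then have "K = {Inf K..Sup K}" "Inf K \<le> Sup K" using K E(1) by (auto simp: less_imp_le)
        then have "emeasure ?\<mu> K = ennreal (F (Sup K) - F (Inf K))" using Icc by metis
        then show "measure ?\<mu> K = \<bar>F (Sup K) - F (Inf K)\<bar>"
          using monoD[OF F(1) \<open>Inf K \<le> Sup K\<close>] by (simp add: measure_def)
      qed simp
      also have "\<dots> = variation_sum F ?D"
        unfolding variation_sum_def by (simp add: sum.reindex[OF inj])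
      finally show ?thesis using v by simp
    qed
    have fm: "K \<in> fmeasurable ?\<mu>" if "K \<in> \<D>" for K
    proof -
      have "K = {Inf K..Sup K}" "Inf K \<le> Sup K" using K that by (auto simp: less_imp_le)
      moreover from this(2) have "{Inf K..Sup K} \<in> fmeasurable ?\<mu>"
        by (intro fmeasurableI) (simp_all add: Icc)
      ultimately show ?thesis by metis
    qed
    have "emeasure ?\<mu> (\<Union>\<D>) \<le> ennreal e"
      using measure_Union_bound[OF \<D>(1) fm bound] fmeasurable_Union_bound[OF \<D>(1) fm bound]
      by (simp add: emeasure_eq_measure2 ennreal_leI)
    moreover have "\<Union>\<D> \<in> sets ?\<mu>"
      using fmeasurable_Union_bound[OF \<D>(1) fm bound] by (rule fmeasurableD)
    ultimately show ?thesis
      using emeasure_mono[OF \<D>(5)] by (metis order_trans)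
  qed
  have zero: "N \<inter> {- r..r} \<in> null_sets ?\<mu>" if "r > 0" for r
  proof -
    have "emeasure ?\<mu> (N \<inter> {-r..r}) \<le> 0"
    proof (rule ennreal_le_epsilon)
      fix e :: real assume "0 < e"
      from small[OF that this] show "emeasure ?\<mu> (N \<inter> {-r..r}) \<le> 0 + ennreal e" by simp
    qed
    then show ?thesis using meas by auto
  qed
  have "(\<Union>n::nat. N \<inter> {- real (Suc n)..real (Suc n)}) \<in> null_sets ?\<mu>"
    by (intro null_sets_UN zero) simp
  moreover have "(\<Union>n::nat. N \<inter> {- real (Suc n)..real (Suc n)}) = N"
  proof -
    have "\<exists>n::nat. x \<in> {- real (Suc n)..real (Suc n)}" for x :: real
    proof -
      obtain n::nat where "\<bar>x\<bar> \<le> real n" using real_arch_simple by blast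
      then show ?thesis by (intro exI[of _ n]) auto
    qed
    then show ?thesis by blast
  qed
  ultimately show ?thesis by simp
qed

lemma mono_ac_families_density:
  assumes F: "mono F" "ac_families F"
  obtains h where "\<And>x y. x \<le> y \<Longrightarrow> (h has_integral (F y - F x)) {x..y}"
proof -
  let ?\<mu> = "interval_measure F"
  have cont: "continuous_on UNIV F" by (rule ac_families_continuous[OF F(2)])
  have Icc: "emeasure ?\<mu> {c..d} = ennreal (F d - F c)" if "c \<le> d" for c d
    using that monoD[OF F(1)] cont by (intro emeasure_interval_measure_Icc) auto
  have "absolutely_continuous lborel ?\<mu>"
    unfolding absolutely_continuous_def using interval_measure_null[OF F] by blast
  then obtain g where g: "g \<in> borel_measurable lborel" "density lborel g = ?\<mu>"
    using sigma_finite_measure.Radon_Nikodym[OF sigma_finite_lborel, of ?\<mu>] by auto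
  have int: "(\<integral>\<^sup>+t. g t * indicator {x..y} t \<partial>lborel) = ennreal (F y - F x)" if "x \<le> y" for x y
    using Icc[OF that] g by (metis emeasure_density atLeastAtMost_borel sets_lborel)
  \<comment> \<open>The Radon-Nikodym density takes extended values; its integral over each window
    is finite, so it is finite almost everywhere and can be made real.\<close>
  have fin: "AE t in lborel. g t \<noteq> \<infinity>"
  proof -
    have "AE t in lborel. \<forall>n::nat. g t * indicator {- real n..real n} t \<noteq> \<infinity>"
      unfolding AE_all_countable using g(1) int by (intro allI nn_integral_PInf_AE) auto
    then show ?thesis
    proof eventually_elim
      case (elim t)
      obtain n::nat where "\<bar>t\<bar> \<le> real n" using real_arch_simple by blast
      then have "t \<in> {- real n..real n}" by auto
      then show ?case using elim[rule_format, of n] by simp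
    qed
  qed
  let ?h = "\<lambda>t. enn2real (g t)"
  have "(?h has_integral (F y - F x)) {x..y}" if "x \<le> y" for x y
  proof -
    have "(\<integral>\<^sup>+t. ennreal (?h t * indicator {x..y} t) \<partial>lborel) = (\<integral>\<^sup>+t. g t * indicator {x..y} t \<partial>lborel)"
      by (rule nn_integral_cong_AE, use fin in eventually_elim) (auto simp: indicator_def ennreal_enn2real less_top)
    then have "((\<lambda>t. ?h t * indicator {x..y} t) has_integral (F y - F x)) UNIV"
      using int[OF that] monoD[OF F(1) that] g(1) by (intro nn_integral_has_integral) auto
    moreover have "(\<lambda>t. ?h t * indicator {x..y} t) = (\<lambda>t. if t \<in> {x..y} then ?h t else 0)" by auto
    ultimately show ?thesis using has_integral_restrict_UNIV by metis
  qed
  then show thesis by (rule that)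
qed

text \<open>The density belongs to the clamped extension of f, so it is integrable over every
  interval of the line, as Lebesgue differentiation requires below.\<close>

lemma abs_continuous_density:
  assumes "abs_continuous_on {a..b} f" "a \<le> b"
  obtains h where "\<And>c d. h integrable_on {c..d}"
    "\<And>x y. a \<le> x \<Longrightarrow> x \<le> y \<Longrightarrow> y \<le> b \<Longrightarrow> (h has_integral (f y - f x)) {x..y}"
proof -
  let ?f = "\<lambda>x. f (max a (min b x))"
  have "ac_families ?f"
    by (intro abs_continuous_imp_ac_families abs_continuous_on_clamp assms)
  moreover have "?f x = ?f a" if "x \<le> a" for x using that assms(2) by (simp add: max_def min_def)
  ultimately obtain p q where pq: "ac_families p" "ac_families q" "mono p" "mono q" "\<And>x. ?f x = p x - q x"
    using ac_families_jordan[of ?f a] by metis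
  obtain h k where h: "\<And>x y. x \<le> y \<Longrightarrow> (h has_integral (p y - p x)) {x..y}"
    and k: "\<And>x y. x \<le> y \<Longrightarrow> (k has_integral (q y - q x)) {x..y}"
    using mono_ac_families_density pq by metis
  have hk: "((\<lambda>t. h t - k t) has_integral (?f y - ?f x)) {x..y}" if "x \<le> y" for x y
  proof -
    have "?f y - ?f x = (p y - p x) - (q y - q x)"
      unfolding pq(5)[of x] pq(5)[of y] by simp
    then show ?thesis using has_integral_diff[OF h[OF that] k[OF that]] by metis
  qed
  show thesis
  proof
    show "(\<lambda>t. h t - k t) integrable_on {c..d}" for c d
      by (cases "c \<le> d") (use hk in \<open>auto simp: integrable_on_empty\<close>)
    show "((\<lambda>t. h t - k t) has_integral (f y - f x)) {x..y}" if "a \<le> x" "x \<le> y" "y \<le> b" for x y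
    proof -
      have "max a (min b x) = x" "max a (min b y) = y" using that by auto
      then show ?thesis using hk[OF that(2)] by simp
    qed
  qed
qed

section \<open>Differentiation almost everywhere and the fundamental theorem of calculus\<close>

lemma integral_right_derivative_AE:
  fixes h :: "real \<Rightarrow> real"
  assumes "\<And>c d. h integrable_on {c..d}"
  obtains N where "negligible N"
    "\<And>x e. \<lbrakk>x \<notin> N; 0 < e\<rbrakk> \<Longrightarrow> \<exists>d>0. \<forall>t. 0 < t \<and> t < d \<longrightarrow> \<bar>integral {x..x + t} h / t - h x\<bar> < e"
proof (rule integrable_ccontinuous_explicit[of h])
  fix N assume N: "negligible N" "\<And>x e. \<lbrakk>x \<notin> N; 0 < e\<rbrakk> \<Longrightarrow> \<exists>d>0. \<forall>t. 0 < t \<and> t < d \<longrightarrow>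
     norm (integral (cbox x (x + t *\<^sub>R One)) h /\<^sub>R t ^ DIM(real) - h x) < e"
  show thesis
    by (rule that[OF N(1)]) (use N(2) in \<open>simp add: divide_inverse mult.commute\<close>)
qed (use assms in simp)

text \<open>The library theorem averages over cubes with lower corner x and so yields right
  derivatives only. Left derivatives of h are right derivatives of its reflection, whose exceptional
  set is reflected back. One exceptional set serves all base points \<open>a\<close>.\<close>

lemma indefinite_integral_has_derivative_AE:
  fixes h :: "real \<Rightarrow> real"
  assumes int: "\<And>c d. h integrable_on {c..d}"
  obtains N where "negligible N"
    "\<And>a x. x \<notin> N \<Longrightarrow> a < x \<Longrightarrow> ((\<lambda>u. integral {a..u} h) has_real_derivative h x) (at x)"
proof -
  obtain N1 where N1: "negligible N1"
    "\<And>x e. \<lbrakk>x \<notin> N1; 0 < e\<rbrakk> \<Longrightarrow> \<exists>d>0. \<forall>t. 0 < t \<and> t < d \<longrightarrow> \<bar>integral {x..x + t} h / t - h x\<bar> < e"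
    using integral_right_derivative_AE[OF int] by metis
  have int': "(\<lambda>x. h (- x)) integrable_on {c..d}" for c d
    using int[of "-d" "-c"] Henstock_Kurzweil_Integration.integrable_reflect_real[where f = h and a = "-d" and b = "-c"] by simp
  obtain N2 where N2: "negligible N2"
    "\<And>x e. \<lbrakk>x \<notin> N2; 0 < e\<rbrakk> \<Longrightarrow> \<exists>d>0. \<forall>t. 0 < t \<and> t < d \<longrightarrow> \<bar>integral {x..x + t} (\<lambda>x. h (- x)) / t - h (- x)\<bar> < e"
    using integral_right_derivative_AE[OF int'] by metis
  let ?N = "N1 \<union> uminus ` N2"
  have "negligible (uminus ` N2)"
    by (rule negligible_differentiable_image_negligible) (use N2(1) in \<open>auto intro!: derivative_intros\<close>)
  then have "negligible ?N" using N1(1) by auto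
  moreover have "((\<lambda>u. integral {a..u} h) has_real_derivative h x) (at x)"
    if x: "x \<notin> ?N" and "a < x" for a x
  proof -
    have nx: "x \<notin> N1" "-x \<notin> N2" using x by (auto simp: image_iff)
    have "\<exists>d>0. \<forall>t. t \<noteq> 0 \<and> norm (t - 0) < d \<longrightarrow> norm ((integral {a..x + t} h - integral {a..x} h) / t - h x) < e"
      if "e > 0" for e
    proof -
      obtain d1 where d1: "d1 > 0" "\<And>t. 0 < t \<Longrightarrow> t < d1 \<Longrightarrow> \<bar>integral {x..x + t} h / t - h x\<bar> < e"
        using N1(2)[OF nx(1) \<open>e > 0\<close>] by blast
      obtain d2 where d2: "d2 > 0" "\<And>t. 0 < t \<Longrightarrow> t < d2 \<Longrightarrow> \<bar>integral {-x..-x + t} (\<lambda>x. h (- x)) / t - h x\<bar> < e"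
        using N2(2)[OF nx(2) \<open>e > 0\<close>] by auto
      \<comment> \<open>The bound x - a keeps x + t to the right of the base point.\<close>
      let ?d = "min (min d1 d2) (x - a)"
      have "norm ((integral {a..x + t} h - integral {a..x} h) / t - h x) < e"
        if t: "t \<noteq> 0 \<and> norm (t - 0) < ?d" for t
      proof (cases "t > 0")
        case True
        then have "integral {a..x} h + integral {x..x + t} h = integral {a..x + t} h"
          using \<open>a < x\<close> int by (intro Henstock_Kurzweil_Integration.integral_combine) auto
        then have "integral {a..x + t} h - integral {a..x} h = integral {x..x + t} h" by simp
        then show ?thesis using d1(2)[OF True] True t by simp
      next
        case False
        then have "t < 0" using t by auto
        have "integral {a..x + t} h + integral {x + t..x} h = integral {a..x} h"
          using t \<open>t < 0\<close> int by (intro Henstock_Kurzweil_Integration.integral_combine) auto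
        moreover have "integral {x + t..x} h = integral {-x..-x + (-t)} (\<lambda>x. h (- x))"
          using Henstock_Kurzweil_Integration.integral_reflect_real[of x "x + t" h] by simp
        ultimately have "integral {a..x + t} h - integral {a..x} h = - integral {-x..-x + (-t)} (\<lambda>x. h (- x))"
          by linarith
        then show ?thesis using d2(2)[of "-t"] t \<open>t < 0\<close> by simp
      qed
      moreover have "?d > 0" using d1(1) d2(1) \<open>a < x\<close> by simp
      ultimately show ?thesis by blast
    qed
    then show ?thesis
      unfolding DERIV_def LIM_eq by blast
  qed
  ultimately show thesis by (rule that)
qed

theorem abs_continuous_derivative:
  assumes ac: "abs_continuous_on {a..b} f" and "a \<le> b"
  obtains h N where "negligible N"
    "\<And>x. x \<in> {a..b} - N \<Longrightarrow> a < x \<and> x < b \<and> (f has_real_derivative h x) (at x)"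
    "\<And>x y. a \<le> x \<Longrightarrow> x \<le> y \<Longrightarrow> y \<le> b \<Longrightarrow> (h has_integral (f y - f x)) {x..y}"
proof -
  obtain h where h: "\<And>c d. h integrable_on {c..d}"
    "\<And>x y. a \<le> x \<Longrightarrow> x \<le> y \<Longrightarrow> y \<le> b \<Longrightarrow> (h has_integral (f y - f x)) {x..y}"
    using abs_continuous_density[OF assms] by metis
  obtain N where N: "negligible N"
    "\<And>c x. x \<notin> N \<Longrightarrow> c < x \<Longrightarrow> ((\<lambda>u. integral {c..u} h) has_real_derivative h x) (at x)"
    using indefinite_integral_has_derivative_AE[OF h(1)] by metis
  \<comment> \<open>Nothing is known about f outside the interval, so its endpoints join the
    exceptional set; elsewhere the derivative is two-sided.\<close>
  show thesis
  proof (rule that[of "N \<union> {a, b}" h])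
    show "negligible (N \<union> {a, b})" using N(1) by simp
    fix x assume x: "x \<in> {a..b} - (N \<union> {a, b})"
    then have "a < x" "x < b" by auto
    have "((\<lambda>u. f a + integral {a..u} h) has_real_derivative h x) (at x)"
      using N(2)[of x a] x \<open>a < x\<close> by (auto intro!: derivative_eq_intros)
    then have "(f has_real_derivative h x) (at x)"
    proof (rule DERIV_cong_ev[OF refl _ refl, THEN iffD1, rotated])
      have "\<forall>\<^sub>F u in nhds x. u \<in> {a<..<b}"
        using \<open>a < x\<close> \<open>x < b\<close> by (intro eventually_nhds_in_open) auto
      then show "\<forall>\<^sub>F u in nhds x. f a + integral {a..u} h = f u"
      proof eventually_elim
        case (elim u)
        then show ?case using integral_unique[OF h(2)[of a u]] by auto
      qed
    qed
    then show "a < x \<and> x < b \<and> (f has_real_derivative h x) (at x)"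
      using \<open>a < x\<close> \<open>x < b\<close> by blast
  qed (use h(2) in auto)
qed

text \<open>Uniqueness of derivatives identifies any almost everywhere derivative g with the
  density, so callers may bring their own formula for it.\<close>

lemma abs_continuous_FTC:
  assumes "abs_continuous_on {a..b} f" "a \<le> b" "negligible N"
    and "\<And>x. x \<in> {a..b} - N \<Longrightarrow> (f has_real_derivative g x) (at x)"
  shows "(g has_integral (f b - f a)) {a..b}"
proof -
  obtain h N' where h: "negligible N'"
    "\<And>x. x \<in> {a..b} - N' \<Longrightarrow> a < x \<and> x < b \<and> (f has_real_derivative h x) (at x)"
    "\<And>x y. a \<le> x \<Longrightarrow> x \<le> y \<Longrightarrow> y \<le> b \<Longrightarrow> (h has_integral (f y - f x)) {x..y}"
    using abs_continuous_derivative[OF assms(1,2)] by metis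
  show ?thesis
  proof (rule has_integral_spike)
    show "negligible (N \<union> N')" using assms(3) h(1) by simp
    show "(h has_integral (f b - f a)) {a..b}" using h(3) assms(2) by simp
    show "g x = h x" if "x \<in> {a..b} - (N \<union> N')" for x
      using that h(2) assms(4) by (intro DERIV_unique[of f]) auto
  qed
qed

section \<open>Sources of absolutely continuous functions\<close>

lemma abs_continuous_on_subset:
  "abs_continuous_on S f \<Longrightarrow> T \<subseteq> S \<Longrightarrow> abs_continuous_on T f"
  unfolding abs_continuous_on_def by (meson subsetD)

lemma abs_continuous_on_id: "abs_continuous_on S (\<lambda>x. x)"
  unfolding abs_continuous_on_def
proof (intro allI impI)
  fix e :: real assume "e > 0"
  show "\<exists>d>0. \<forall>(n::nat) (a::nat \<Rightarrow> real) b. (\<forall>k<n. a k \<in> S \<and> b k \<in> S \<and> a k \<le> b k) \<and>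
        (\<forall>k. Suc k < n \<longrightarrow> b k \<le> a (Suc k)) \<and> (\<Sum>k<n. b k - a k) < d
        \<longrightarrow> (\<Sum>k<n. \<bar>b k - a k\<bar>) < e"
  proof (intro exI[of _ e] conjI allI impI \<open>e > 0\<close>)
    fix n :: nat and a b :: "nat \<Rightarrow> real"
    assume A: "(\<forall>k<n. a k \<in> S \<and> b k \<in> S \<and> a k \<le> b k) \<and>
        (\<forall>k. Suc k < n \<longrightarrow> b k \<le> a (Suc k)) \<and> (\<Sum>k<n. b k - a k) < e"
    then have "(\<Sum>k<n. \<bar>b k - a k\<bar>) = (\<Sum>k<n. b k - a k)" by (intro sum.cong) auto
    then show "(\<Sum>k<n. \<bar>b k - a k\<bar>) < e" using A by simp
  qed
qed

text \<open>The common source of the rules for Lipschitz functions, differences and products: each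
  of them is an estimate of increments.\<close>

lemma abs_continuous_on_dominated:
  assumes f: "abs_continuous_on S f" and g: "abs_continuous_on S g" and "A \<ge> 0" "B \<ge> 0"
    and le: "\<And>u v. u \<in> S \<Longrightarrow> v \<in> S \<Longrightarrow> \<bar>k v - k u\<bar> \<le> A * \<bar>f v - f u\<bar> + B * \<bar>g v - g u\<bar>"
  shows "abs_continuous_on S k"
  unfolding abs_continuous_on_def
proof (intro allI impI)
  fix e :: real assume "e > 0"
  \<comment> \<open>The summand 1 makes the final estimate strict and covers A = B = 0.\<close>
  define e' where "e' = e / (A + B + 1)"
  have "e' > 0" using \<open>e > 0\<close> assms(3,4) by (simp add: e'_def)
  obtain d1 where d1: "d1 > 0" "\<forall>(n::nat) a b. (\<forall>k<n. a k \<in> S \<and> b k \<in> S \<and> a k \<le> b k) \<and>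
        (\<forall>k. Suc k < n \<longrightarrow> b k \<le> a (Suc k)) \<and> (\<Sum>k<n. b k - a k) < d1
        \<longrightarrow> (\<Sum>k<n. \<bar>f (b k) - f (a k)\<bar>) < e'"
    using f[unfolded abs_continuous_on_def, rule_format, OF \<open>e' > 0\<close>] by auto
  obtain d2 where d2: "d2 > 0" "\<forall>(n::nat) a b. (\<forall>k<n. a k \<in> S \<and> b k \<in> S \<and> a k \<le> b k) \<and>
        (\<forall>k. Suc k < n \<longrightarrow> b k \<le> a (Suc k)) \<and> (\<Sum>k<n. b k - a k) < d2
        \<longrightarrow> (\<Sum>k<n. \<bar>g (b k) - g (a k)\<bar>) < e'"
    using g[unfolded abs_continuous_on_def, rule_format, OF \<open>e' > 0\<close>] by auto
  show "\<exists>d>0. \<forall>(n::nat) (a::nat \<Rightarrow> real) b. (\<forall>k<n. a k \<in> S \<and> b k \<in> S \<and> a k \<le> b k) \<and>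
        (\<forall>k. Suc k < n \<longrightarrow> b k \<le> a (Suc k)) \<and> (\<Sum>k<n. b k - a k) < d
        \<longrightarrow> (\<Sum>j<n. \<bar>k (b j) - k (a j)\<bar>) < e"
  proof (intro exI[of _ "min d1 d2"] conjI allI impI)
    fix n :: nat and a b :: "nat \<Rightarrow> real"
    assume A: "(\<forall>k<n. a k \<in> S \<and> b k \<in> S \<and> a k \<le> b k) \<and>
        (\<forall>k. Suc k < n \<longrightarrow> b k \<le> a (Suc k)) \<and> (\<Sum>k<n. b k - a k) < min d1 d2"
    have 1: "(\<Sum>k<n. \<bar>f (b k) - f (a k)\<bar>) < e'" and 2: "(\<Sum>k<n. \<bar>g (b k) - g (a k)\<bar>) < e'"
      using A d1(2)[rule_format, of n a b] d2(2)[rule_format, of n a b] by auto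
    have "(\<Sum>j<n. \<bar>k (b j) - k (a j)\<bar>) \<le> (\<Sum>j<n. A * \<bar>f (b j) - f (a j)\<bar> + B * \<bar>g (b j) - g (a j)\<bar>)"
      using A le by (intro sum_mono) auto
    also have "\<dots> = A * (\<Sum>k<n. \<bar>f (b k) - f (a k)\<bar>) + B * (\<Sum>k<n. \<bar>g (b k) - g (a k)\<bar>)"
      by (simp add: sum.distrib sum_distrib_left)
    also have "\<dots> \<le> A * e' + B * e'"
      using 1 2 assms(3,4) by (intro add_mono mult_left_mono) auto
    also have "\<dots> < (A + B + 1) * e'" using \<open>e' > 0\<close> by (simp add: algebra_simps)
    also have "\<dots> = e" using assms(3,4) by (simp add: e'_def)
    finally show "(\<Sum>j<n. \<bar>k (b j) - k (a j)\<bar>) < e" .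
  qed (use d1(1) d2(1) in simp)
qed

lemma abs_continuous_on_lipschitz:
  assumes "L \<ge> 0" "\<And>u v. u \<in> S \<Longrightarrow> v \<in> S \<Longrightarrow> \<bar>f v - f u\<bar> \<le> L * \<bar>v - u\<bar>"
  shows "abs_continuous_on S f"
  by (rule abs_continuous_on_dominated[OF abs_continuous_on_id abs_continuous_on_id assms(1) order.refl])
     (use assms(2) in auto)

lemma abs_continuous_on_diff:
  assumes "abs_continuous_on S f" "abs_continuous_on S g"
  shows "abs_continuous_on S (\<lambda>x. f x - g x)"
  by (rule abs_continuous_on_dominated[OF assms, of 1 1]) auto

lemma abs_continuous_on_mult:
  fixes f g :: "real \<Rightarrow> real"
  assumes "abs_continuous_on S f" "abs_continuous_on S g" "A \<ge> 0" "B \<ge> 0"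
    and bd: "\<And>x. x \<in> S \<Longrightarrow> \<bar>f x\<bar> \<le> A" "\<And>x. x \<in> S \<Longrightarrow> \<bar>g x\<bar> \<le> B"
  shows "abs_continuous_on S (\<lambda>x. f x * g x)"
proof (rule abs_continuous_on_dominated[OF assms(1,2,4,3)])
  fix u v assume uv: "u \<in> S" "v \<in> S"
  have "f v * g v - f u * g u = g v * (f v - f u) + f u * (g v - g u)" by (simp add: algebra_simps)
  also have "\<bar>\<dots>\<bar> \<le> \<bar>g v\<bar> * \<bar>f v - f u\<bar> + \<bar>f u\<bar> * \<bar>g v - g u\<bar>"
    by (metis abs_mult abs_triangle_ineq)
  also have "\<dots> \<le> B * \<bar>f v - f u\<bar> + A * \<bar>g v - g u\<bar>"
    using bd uv by (intro add_mono mult_right_mono) auto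
  finally show "\<bar>f v * g v - f u * g u\<bar> \<le> B * \<bar>f v - f u\<bar> + A * \<bar>g v - g u\<bar>" .
qed

lemma abs_continuous_on_imp_continuous_on:
  assumes "abs_continuous_on {a..b} f"
  shows "continuous_on {a..b} f"
proof (cases "a \<le> b")
  case True
  then have "continuous_on UNIV (\<lambda>x. f (max a (min b x)))"
    by (intro ac_families_continuous abs_continuous_imp_ac_families abs_continuous_on_clamp assms)
  then have "continuous_on {a..b} (\<lambda>x. f (max a (min b x)))"
    by (rule continuous_on_subset) simp
  then show ?thesis
    by (rule continuous_on_eq) (auto simp: max_def min_def)
qed simp

text \<open>Telescoping: for increasing G, the gaps between consecutive intervals can only add to
  the total increment.\<close>

lemma sum_increments_le:
  fixes G :: "real \<Rightarrow> real"
  assumes G: "mono_on {c..d} G"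
    and uv: "\<And>k. k < n \<Longrightarrow> u k \<in> {c..d} \<and> v k \<in> {c..d} \<and> u k \<le> v k"
    "\<And>k. Suc k < n \<Longrightarrow> v k \<le> u (Suc k)" and "0 < n"
  shows "(\<Sum>k<n. G (v k) - G (u k)) \<le> G (v (n - 1)) - G c"
  using uv \<open>0 < n\<close>
proof (induction n)
  case (Suc n)
  show ?case
  proof (cases "n = 0")
    case True
    then show ?thesis
      using Suc.prems(1)[of 0] mono_onD[OF G, of c "u 0"] by auto
  next
    case False
    then have "(\<Sum>k<n. G (v k) - G (u k)) \<le> G (v (n - 1)) - G c"
      using Suc by auto
    moreover have "G (v (n - 1)) \<le> G (u n)"
      using Suc.prems(1)[of "n - 1"] Suc.prems(1)[of n] Suc.prems(2)[of "n - 1"] False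
      by (intro mono_onD[OF G]) auto
    ultimately show ?thesis by simp
  qed
qed simp

text \<open>In place of the Cauchy-Schwarz inequality, integrate the pointwise bound of |h| by
  \<delta> h^2 + 1/(4 \<delta>). Summed over the intervals, the first term is controlled by the full
  integral of h^2 and the second by the total length.\<close>

lemma abs_continuous_on_integral_square:
  fixes h :: "real \<Rightarrow> real"
  assumes h: "h integrable_on {c..d}" and h2: "(\<lambda>x. (h x)\<^sup>2) integrable_on {c..d}"
  shows "abs_continuous_on {c..d} (\<lambda>x. integral {c..x} h)"
  unfolding abs_continuous_on_def
proof (intro allI impI)
  fix e :: real assume "e > 0"
  define G where "G = (\<lambda>x. integral {c..x} (\<lambda>x. (h x)\<^sup>2))"
  define I where "I = integral {c..d} (\<lambda>x. (h x)\<^sup>2)"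
  have "I \<ge> 0" unfolding I_def by (rule integral_nonneg[OF h2]) simp
  \<comment> \<open>Chosen so that \<delta> I <= e/2; the summand 1 covers I = 0. The length bound
    \<eta> = 2 e \<delta> below makes the other term e/2.\<close>
  define \<delta> where "\<delta> = e / (2 * (I + 1))"
  have "\<delta> > 0" using \<open>e > 0\<close> \<open>I \<ge> 0\<close> by (simp add: \<delta>_def)
  have sub: "h integrable_on {u..v}" "(\<lambda>x. (h x)\<^sup>2) integrable_on {u..v}" if "c \<le> u" "v \<le> d" for u v
    using that by (auto intro: integrable_subinterval_real[OF h] integrable_subinterval_real[OF h2])
  have G_diff: "integral {u..v} (\<lambda>x. (h x)\<^sup>2) = G v - G u" if "c \<le> u" "u \<le> v" "v \<le> d" for u v
    using Henstock_Kurzweil_Integration.integral_combine[OF that(1,2) sub(2)[of c v]] that by (simp add: G_def)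
  have h_diff: "integral {u..v} h = integral {c..v} h - integral {c..u} h" if "c \<le> u" "u \<le> v" "v \<le> d" for u v
    using Henstock_Kurzweil_Integration.integral_combine[OF that(1,2) sub(1)[of c v]] that by simp
  have G_mono: "mono_on {c..d} G"
  proof (rule mono_onI)
    fix u v assume "u \<in> {c..d}" "v \<in> {c..d}" "u \<le> v"
    then have "0 \<le> G v - G u"
      using G_diff[of u v] Henstock_Kurzweil_Integration.integral_nonneg[OF sub(2)[of u v]] by force
    then show "G u \<le> G v" by simp
  qed
  have bound: "\<bar>integral {c..v} h - integral {c..u} h\<bar> \<le> \<delta> * (G v - G u) + (v - u) / (4 * \<delta>)"
    if "c \<le> u" "u \<le> v" "v \<le> d" for u v
  proof -
    have amgm: "\<bar>h x\<bar> \<le> \<delta> * (h x)\<^sup>2 + 1 / (4 * \<delta>)" for x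
    proof -
      have "0 \<le> \<delta> * (\<bar>h x\<bar> - 1 / (2 * \<delta>))\<^sup>2" using \<open>\<delta> > 0\<close> by simp
      also have "\<dots> = \<delta> * (h x)\<^sup>2 + 1 / (4 * \<delta>) - \<bar>h x\<bar>"
        using \<open>\<delta> > 0\<close> by (simp add: power2_eq_square field_simps)
      finally show ?thesis by simp
    qed
    have int: "((\<lambda>x. \<delta> * (h x)\<^sup>2 + 1 / (4 * \<delta>)) has_integral \<delta> * (G v - G u) + (v - u) * (1 / (4 * \<delta>))) {u..v}"
      using that sub(2)[of u v] G_diff[OF that, symmetric]
      by (intro has_integral_add has_integral_mult_right)
         (auto simp: integrable_integral intro: has_integral_const_real[THEN has_integral_eq_rhs])
    have "norm (integral {u..v} h) \<le> integral {u..v} (\<lambda>x. \<delta> * (h x)\<^sup>2 + 1 / (4 * \<delta>))"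
      using amgm sub(1)[of u v] that int by (intro integral_norm_bound_integral) (auto simp: has_integral_iff)
    then show ?thesis
      using integral_unique[OF int] h_diff[OF that] by simp
  qed
  define \<eta> where "\<eta> = 2 * e * \<delta>"
  show "\<exists>d'>0. \<forall>(n::nat) (u::nat \<Rightarrow> real) v. (\<forall>k<n. u k \<in> {c..d} \<and> v k \<in> {c..d} \<and> u k \<le> v k) \<and>
        (\<forall>k. Suc k < n \<longrightarrow> v k \<le> u (Suc k)) \<and> (\<Sum>k<n. v k - u k) < d'
        \<longrightarrow> (\<Sum>k<n. \<bar>integral {c..v k} h - integral {c..u k} h\<bar>) < e"
  proof (intro exI[of _ \<eta>] conjI allI impI)
    show "\<eta> > 0" using \<open>e > 0\<close> \<open>\<delta> > 0\<close> by (simp add: \<eta>_def)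
    fix n :: nat and u v :: "nat \<Rightarrow> real"
    assume uv: "(\<forall>k<n. u k \<in> {c..d} \<and> v k \<in> {c..d} \<and> u k \<le> v k) \<and>
        (\<forall>k. Suc k < n \<longrightarrow> v k \<le> u (Suc k)) \<and> (\<Sum>k<n. v k - u k) < \<eta>"
    show "(\<Sum>k<n. \<bar>integral {c..v k} h - integral {c..u k} h\<bar>) < e"
    proof (cases "n = 0")
      case False
      have "(\<Sum>k<n. G (v k) - G (u k)) \<le> G (v (n - 1)) - G c"
        using uv False by (intro sum_increments_le[OF G_mono]) auto
      also have "\<dots> \<le> I"
        using uv False mono_onD[OF G_mono, of "v (n - 1)" d] by (auto simp: I_def G_def)
      finally have GI: "(\<Sum>k<n. G (v k) - G (u k)) \<le> I" .
      have "(\<Sum>k<n. \<bar>integral {c..v k} h - integral {c..u k} h\<bar>)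
          \<le> (\<Sum>k<n. \<delta> * (G (v k) - G (u k)) + (v k - u k) / (4 * \<delta>))"
        using uv by (intro sum_mono bound) auto
      also have "\<dots> = \<delta> * (\<Sum>k<n. G (v k) - G (u k)) + (\<Sum>k<n. v k - u k) / (4 * \<delta>)"
        by (simp add: sum.distrib sum_distrib_left sum_divide_distrib)
      also have "\<dots> < \<delta> * I + \<eta> / (4 * \<delta>)"
        using GI uv \<open>\<delta> > 0\<close> by (intro add_le_less_mono mult_left_mono divide_strict_right_mono) auto
      also have "\<dots> \<le> e / 2 + e / 2"
      proof (intro add_mono)
        show "\<delta> * I \<le> e / 2" using \<open>e > 0\<close> \<open>I \<ge> 0\<close> by (simp add: \<delta>_def field_simps)
        show "\<eta> / (4 * \<delta>) \<le> e / 2" using \<open>\<delta> > 0\<close> by (simp add: \<eta>_def)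
      qed
      finally show ?thesis by simp
    qed (use \<open>e > 0\<close> in simp)
  qed
qed

section \<open>Completeness of square integrable functions\<close>

definition square_integrable :: "'a measure \<Rightarrow> ('a \<Rightarrow> real) \<Rightarrow> bool" where
  "square_integrable M f \<longleftrightarrow> f \<in> borel_measurable M \<and> integrable M (\<lambda>x. (f x)\<^sup>2)"

lemma square_integrable_mult:
  assumes "square_integrable M f" "square_integrable M g"
  shows "integrable M (\<lambda>x. f x * g x)"
proof (rule Bochner_Integration.integrable_bound)
  show "integrable M (\<lambda>x. (f x)\<^sup>2 + (g x)\<^sup>2)"
    using assms by (auto simp: square_integrable_def)
  have "\<bar>f x * g x\<bar> \<le> (f x)\<^sup>2 + (g x)\<^sup>2" for x
  proof -
    have "2 * (\<bar>f x\<bar> * \<bar>g x\<bar>) \<le> (f x)\<^sup>2 + (g x)\<^sup>2"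
      using sum_squares_bound[of "\<bar>f x\<bar>" "\<bar>g x\<bar>"] by (simp add: mult.assoc)
    moreover have "0 \<le> \<bar>f x\<bar> * \<bar>g x\<bar>" by simp
    ultimately show ?thesis unfolding abs_mult by linarith
  qed
  then show "AE x in M. norm (f x * g x) \<le> norm ((f x)\<^sup>2 + (g x)\<^sup>2)" by simp
qed (use assms in \<open>auto simp: square_integrable_def\<close>)

lemma square_integrable_diff:
  assumes "square_integrable M f" "square_integrable M g"
  shows "square_integrable M (\<lambda>x. f x - g x)"
proof -
  have "integrable M (\<lambda>x. (f x)\<^sup>2 + (g x)\<^sup>2 - 2 * (f x * g x))"
    using assms square_integrable_mult[OF assms] by (auto simp: square_integrable_def)
  then show ?thesis
    using assms by (auto simp: square_integrable_def power2_diff mult.assoc)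
qed

lemma (in finite_measure) square_integrable_integrable:
  assumes "square_integrable M f"
  shows "integrable M f"
  using square_integrable_mult[OF assms, of "\<lambda>_. 1"] by (simp add: square_integrable_def)

text \<open>Another weighted form of the arithmetic-geometric mean inequality. The free weight
  \<open>c\<close> is later adapted to the rate of decay of a sequence.\<close>

lemma (in finite_measure) integral_abs_le_square:
  assumes f: "square_integrable M f" and "c > 0"
  shows "(\<integral>x. \<bar>f x\<bar> \<partial>M) \<le> c * (\<integral>x. (f x)\<^sup>2 \<partial>M) + measure M (space M) / c"
proof -
  have "(\<integral>x. \<bar>f x\<bar> \<partial>M) \<le> (\<integral>x. c * (f x)\<^sup>2 + 1 / c \<partial>M)"
  proof (rule integral_mono)
    fix x
    have "0 \<le> c * (\<bar>f x\<bar> - 1 / (2 * c))\<^sup>2" using \<open>c > 0\<close> by simp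
    also have "\<dots> = c * (f x)\<^sup>2 + 1 / (4 * c) - \<bar>f x\<bar>"
      using \<open>c > 0\<close> by (simp add: power2_eq_square field_simps)
    also have "\<dots> \<le> c * (f x)\<^sup>2 + 1 / c - \<bar>f x\<bar>" using \<open>c > 0\<close> by (simp add: field_simps)
    finally show "\<bar>f x\<bar> \<le> c * (f x)\<^sup>2 + 1 / c" by simp
  qed (use f square_integrable_integrable[OF f] in \<open>auto simp: square_integrable_def\<close>)
  also have "\<dots> = c * (\<integral>x. (f x)\<^sup>2 \<partial>M) + measure M (space M) / c"
    using f by (simp add: square_integrable_def)
  finally show ?thesis .
qed

text \<open>Riesz-Fischer: a rapidly converging subsequence has increments summable in L^1, hence it
  converges almost everywhere, and Fatou's lemma turns this into convergence of the whole sequence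
  in L^2.\<close>

theorem (in finite_measure) square_integrable_complete:
  fixes u :: "nat \<Rightarrow> 'a \<Rightarrow> real"
  assumes u: "\<And>n. square_integrable M (u n)"
    and cauchy: "\<And>e. e > 0 \<Longrightarrow> \<exists>N. \<forall>m\<ge>N. \<forall>n\<ge>N. (\<integral>x. (u m x - u n x)\<^sup>2 \<partial>M) < e"
  obtains h where "square_integrable M h" "(\<lambda>n. \<integral>x. (u n x - h x)\<^sup>2 \<partial>M) \<longlonglongrightarrow> 0"
proof -
  have [measurable]: "u n \<in> borel_measurable M" for n
    using u by (simp add: square_integrable_def)
  have "\<exists>N. \<forall>m\<ge>N. \<forall>n\<ge>N. (\<integral>x. (u m x - u n x)\<^sup>2 \<partial>M) < (1/4)^k" for k :: nat
    by (rule cauchy) simp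
  then obtain \<rho> where \<rho>: "\<And>k m n. m \<ge> \<rho> k \<Longrightarrow> n \<ge> \<rho> k \<Longrightarrow> (\<integral>x. (u m x - u n x)\<^sup>2 \<partial>M) < (1/4)^k"
    by metis
  \<comment> \<open>Partial sums make the indices increasing and at least \<rho> k; the extra k
    gives r k >= k, so k >= N suffices later on.\<close>
  define r where "r k = (\<Sum>j\<le>k. \<rho> j) + k" for k
  have r_ge: "\<rho> k \<le> r k" "k \<le> r k" "r k \<le> r (Suc k)" for k
    by (auto simp: r_def intro: trans_le_add1 member_le_sum)
  define w where "w k x = u (r (Suc k)) x - u (r k) x" for k x
  have w: "square_integrable M (w k)" for k
    unfolding w_def by (intro square_integrable_diff u)
  have [measurable]: "w k \<in> borel_measurable M" for k
    using w by (simp add: square_integrable_def)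
  let ?C = "1 + measure M (space M)"
  \<comment> \<open>The weight 2^k balances both terms: 2^k (1/4)^k and the total mass over 2^k
    decay like (1/2)^k.\<close>
  have w_L1: "(\<integral>x. \<bar>w k x\<bar> \<partial>M) \<le> ?C * (1/2)^k" for k
  proof -
    have "(\<integral>x. (w k x)\<^sup>2 \<partial>M) \<le> (1/4)^k"
      unfolding w_def using r_ge[of k] \<rho>[of k "r (Suc k)" "r k"] by simp
    then have "2^k * (\<integral>x. (w k x)\<^sup>2 \<partial>M) \<le> 2^k * (1/4)^k" by simp
    also have "\<dots> = (1/2 :: real)^k" by (simp flip: power_mult_distrib)
    finally have "2^k * (\<integral>x. (w k x)\<^sup>2 \<partial>M) + measure M (space M) / 2^k \<le> ?C * (1/2)^k"
      by (simp add: field_simps power_divide)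
    then show ?thesis using integral_abs_le_square[OF w, of "2^k" k] by simp
  qed
  have "(\<integral>\<^sup>+x. (\<Sum>k. ennreal \<bar>w k x\<bar>) \<partial>M) = (\<Sum>k. \<integral>\<^sup>+x. ennreal \<bar>w k x\<bar> \<partial>M)"
    by (rule nn_integral_suminf) simp
  also have "\<dots> = (\<Sum>k. ennreal (\<integral>x. \<bar>w k x\<bar> \<partial>M))"
    using square_integrable_integrable[OF w] by (intro suminf_cong nn_integral_eq_integral) auto
  also have "\<dots> \<le> (\<Sum>k. ennreal (?C * (1/2)^k))"
    by (intro suminf_le ennreal_leI w_L1) auto
  also have "\<dots> < \<infinity>"
    by (simp add: suminf_ennreal2 summable_mult summable_geometric)
  finally have "(\<integral>\<^sup>+x. (\<Sum>k. ennreal \<bar>w k x\<bar>) \<partial>M) \<noteq> \<infinity>" by simp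
  then have "AE x in M. (\<Sum>k. ennreal \<bar>w k x\<bar>) \<noteq> \<infinity>"
    by (intro nn_integral_PInf_AE) auto
  then have conv: "AE x in M. convergent (\<lambda>k. u (r k) x)"
  proof eventually_elim
    case (elim x)
    then have "summable (\<lambda>k. \<bar>w k x\<bar>)"
      by (intro summable_suminf_not_top) auto
    then have "summable (\<lambda>k. w k x)" by (rule summable_rabs_cancel)
    then have "convergent (\<lambda>n. \<Sum>k<n. w k x)" by (simp add: summable_iff_convergent)
    moreover have "(\<Sum>k<n. w k x) = u (r n) x - u (r 0) x" for n
      unfolding w_def by (rule sum_lessThan_telescope)
    ultimately have "convergent (\<lambda>n. u (r n) x - u (r 0) x)" by simp
    from convergent_add[OF this convergent_const[of "u (r 0) x"]] show ?case by simp
  qed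
  \<comment> \<open>Where the subsequence diverges, \<open>lim\<close> is one fixed unspecified
    number; this happens only on a null set.\<close>
  define h where "h x = lim (\<lambda>k. u (r k) x)" for x
  have [measurable]: "h \<in> borel_measurable M" unfolding h_def by measurable
  \<comment> \<open>The index n stays fixed while u (r k) runs to its pointwise limit h.\<close>
  have fatou: "(\<integral>\<^sup>+x. ennreal ((u n x - h x)\<^sup>2) \<partial>M) \<le> ennreal e"
    if N: "\<And>m n. m \<ge> N \<Longrightarrow> n \<ge> N \<Longrightarrow> (\<integral>x. (u m x - u n x)\<^sup>2 \<partial>M) < e" and "n \<ge> N" for n N e
  proof -
    have "(\<integral>\<^sup>+x. ennreal ((u n x - h x)\<^sup>2) \<partial>M) = (\<integral>\<^sup>+x. liminf (\<lambda>k. ennreal ((u n x - u (r k) x)\<^sup>2)) \<partial>M)"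
    proof (rule nn_integral_cong_AE, use conv in eventually_elim)
      case (elim x)
      then have "(\<lambda>k. u (r k) x) \<longlonglongrightarrow> h x"
        unfolding h_def by (simp add: convergent_LIMSEQ_iff)
      then have "(\<lambda>k. ennreal ((u n x - u (r k) x)\<^sup>2)) \<longlonglongrightarrow> ennreal ((u n x - h x)\<^sup>2)"
        by (intro tendsto_intros)
      then show ?case by (intro lim_imp_Liminf[symmetric]) auto
    qed
    also have "\<dots> \<le> liminf (\<lambda>k. \<integral>\<^sup>+x. ennreal ((u n x - u (r k) x)\<^sup>2) \<partial>M)"
      by (rule nn_integral_liminf) simp
    also have "\<dots> \<le> ennreal e"
    proof (rule Liminf_le)
      show "\<forall>\<^sub>F k in sequentially. (\<integral>\<^sup>+x. ennreal ((u n x - u (r k) x)\<^sup>2) \<partial>M) \<le> ennreal e"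
        using eventually_ge_at_top[of N]
      proof eventually_elim
        case (elim k)
        have "(\<integral>\<^sup>+x. ennreal ((u n x - u (r k) x)\<^sup>2) \<partial>M) = ennreal (\<integral>x. (u n x - u (r k) x)\<^sup>2 \<partial>M)"
          using square_integrable_diff[OF u[of n] u[of "r k"]]
          by (intro nn_integral_eq_integral) (auto simp: square_integrable_def)
        also have "\<dots> \<le> ennreal e"
          using N[OF \<open>n \<ge> N\<close>, of "r k"] r_ge(2)[of k] elim by (intro ennreal_leI) auto
        finally show ?case .
      qed
    qed simp
    finally show ?thesis .
  qed
  have diff: "square_integrable M (\<lambda>x. u n x - h x) \<and> (\<integral>x. (u n x - h x)\<^sup>2 \<partial>M) \<le> e"
    if N: "\<And>m n. m \<ge> N \<Longrightarrow> n \<ge> N \<Longrightarrow> (\<integral>x. (u m x - u n x)\<^sup>2 \<partial>M) < e" and "n \<ge> N" "e > 0" for n N e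
  proof -
    have le: "(\<integral>\<^sup>+x. ennreal ((u n x - h x)\<^sup>2) \<partial>M) \<le> ennreal e" by (rule fatou[OF that(1,2)])
    then have "(\<integral>\<^sup>+x. ennreal ((u n x - h x)\<^sup>2) \<partial>M) < \<infinity>"
      using le_less_trans[OF _ ennreal_less_top] by simp
    then have int: "integrable M (\<lambda>x. (u n x - h x)\<^sup>2)"
      by (intro integrableI_nonneg) auto
    then have "(\<integral>\<^sup>+x. ennreal ((u n x - h x)\<^sup>2) \<partial>M) = ennreal (\<integral>x. (u n x - h x)\<^sup>2 \<partial>M)"
      by (intro nn_integral_eq_integral) auto
    then show ?thesis using le int \<open>e > 0\<close> by (simp add: square_integrable_def ennreal_le_iff)
  qed
  show thesis
  proof
    obtain N where N: "\<And>m n. m \<ge> N \<Longrightarrow> n \<ge> N \<Longrightarrow> (\<integral>x. (u m x - u n x)\<^sup>2 \<partial>M) < 1"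
      using cauchy[of 1] by auto
    have "square_integrable M (\<lambda>x. u N x - h x)"
      using diff[of N 1 N, OF N] by simp
    from square_integrable_diff[OF u[of N] this] show "square_integrable M h" by simp
    show "(\<lambda>n. \<integral>x. (u n x - h x)\<^sup>2 \<partial>M) \<longlonglongrightarrow> 0"
    proof (rule LIMSEQ_I)
      fix e :: real assume "e > 0"
      then obtain N where N: "\<And>m n. m \<ge> N \<Longrightarrow> n \<ge> N \<Longrightarrow> (\<integral>x. (u m x - u n x)\<^sup>2 \<partial>M) < e/2"
        using cauchy[of "e/2"] by auto
      have "norm ((\<integral>x. (u n x - h x)\<^sup>2 \<partial>M) - 0) < e" if "n \<ge> N" for n
      proof -
        have "(\<integral>x. (u n x - h x)\<^sup>2 \<partial>M) \<le> e/2" using diff[OF N that] \<open>e > 0\<close> by auto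
        moreover have "0 \<le> (\<integral>x. (u n x - h x)\<^sup>2 \<partial>M)" by simp
        ultimately show ?thesis using \<open>e > 0\<close> by simp
      qed
      then show "\<exists>N. \<forall>n\<ge>N. norm ((\<integral>x. (u n x - h x)\<^sup>2 \<partial>M) - 0) < e" by blast
    qed
  qed
qed

section \<open>The space of absolutely continuous functions with square integrable derivative\<close>

lemma finite_measure_Delta: "finite_measure (lebesgue_on Delta)"
  unfolding Delta_def by (intro finite_measure_lebesgue_on lmeasurable_interval)

lemma Delta_sets_lebesgue [simp]: "Delta \<in> sets lebesgue"
  by (simp add: Delta_def)

text \<open>Connects the gauge integrals in \<open>H1\<close> with Lebesgue integration. A
  nonnegative gauge integrable function is absolutely integrable, so for squares the two notions
  agree.\<close>

lemma square_integrable_Delta_iff: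
  "square_integrable (lebesgue_on Delta) f \<longleftrightarrow>
     f measurable_on Delta \<and> (\<lambda>x. (f x)\<^sup>2) integrable_on Delta"
proof
  assume f: "f measurable_on Delta \<and> (\<lambda>x. (f x)\<^sup>2) integrable_on Delta"
  then have "(\<lambda>x. (f x)\<^sup>2) absolutely_integrable_on Delta"
    by (intro nonnegative_absolutely_integrable_1) auto
  then show "square_integrable (lebesgue_on Delta) f"
    using f by (auto simp: square_integrable_def measurable_on_iff_borel_measurable
        intro: absolutely_integrable_imp_integrable)
qed (auto simp: square_integrable_def measurable_on_iff_borel_measurable integrable_on_lebesgue_on)

lemma square_integrable_integrable_on_Delta:
  "square_integrable (lebesgue_on Delta) f \<Longrightarrow> f integrable_on Delta"
  by (intro integrable_on_lebesgue_on finite_measure.square_integrable_integrable finite_measure_Delta) auto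

lemma dDelta_eqI:
  assumes "-(pi/2) < x" "x < pi/2" "(f has_real_derivative D) (at x)"
  shows "dDelta f x = D"
proof -
  have "(f has_vector_derivative D) (at x within cbox (-(pi/2)) (pi/2))"
    using assms(3) by (auto simp: has_real_derivative_iff_has_vector_derivative intro: has_vector_derivative_at_within)
  then show ?thesis
    unfolding dDelta_def Delta_def using vector_derivative_within_cbox[of "-(pi/2)" "pi/2" x f D] assms by simp
qed

lemma H1_derivative:
  assumes "f \<in> H1"
  obtains N where "negligible N"
    "\<And>x. x \<in> Delta - N \<Longrightarrow> -(pi/2) < x \<and> x < pi/2 \<and> (f has_real_derivative dDelta f x) (at x)"
proof -
  have ac: "abs_continuous_on {-(pi/2)..pi/2} f" and "-(pi/2) \<le> pi/2"
    using assms by (simp_all add: H1_def Delta_def)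
  from abs_continuous_derivative[OF this] obtain h N where "negligible N"
    "\<And>x. x \<in> {-(pi/2)..pi/2} - N \<Longrightarrow> -(pi/2) < x \<and> x < pi/2 \<and> (f has_real_derivative h x) (at x)"
    by metis
  then show thesis
    using that[of N] dDelta_eqI unfolding Delta_def by metis
qed

text \<open>Membership is certified by any almost everywhere derivative; the unspecified values of
  \<open>dDelta\<close> on N affect neither measurability nor the integral.\<close>

lemma H1I:
  assumes f: "abs_continuous_on Delta f" and N: "negligible N"
    and g: "\<And>x. x \<in> Delta - N \<Longrightarrow> -(pi/2) < x \<and> x < pi/2 \<and> (f has_real_derivative g x) (at x)"
    and sq: "square_integrable (lebesgue_on Delta) g"
  shows "f \<in> H1"
proof -
  have eq: "dDelta f x = g x" if "x \<in> Delta - N" for x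
    using g[OF that] dDelta_eqI by blast
  have "dDelta f measurable_on Delta"
  proof (rule measurable_on_spike[OF _ N])
    show "g measurable_on Delta" using sq by (simp add: square_integrable_Delta_iff)
  qed (rule eq)
  moreover have "(\<lambda>x. (dDelta f x)\<^sup>2) integrable_on Delta"
  proof (rule integrable_spike[OF _ N])
    show "(\<lambda>x. (g x)\<^sup>2) integrable_on Delta" using sq by (simp add: square_integrable_Delta_iff)
    show "(dDelta f x)\<^sup>2 = (g x)\<^sup>2" if "x \<in> Delta - N" for x using eq[OF that] by simp
  qed
  ultimately show ?thesis using f by (simp add: H1_def)
qed

lemma H1_square_integrable:
  "f \<in> H1 \<Longrightarrow> square_integrable (lebesgue_on Delta) (dDelta f)"
  by (simp add: H1_def square_integrable_Delta_iff)

lemma H1_continuous_on: "f \<in> H1 \<Longrightarrow> continuous_on Delta f"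
  unfolding H1_def Delta_def by (auto intro: abs_continuous_on_imp_continuous_on)

lemma H1_integrable: "f \<in> H1 \<Longrightarrow> f integrable_on Delta"
  using integrable_continuous_real[of "-(pi/2)" "pi/2" f] H1_continuous_on[of f] by (simp add: Delta_def)

lemma H1_diff:
  assumes f: "f \<in> H1" and g: "g \<in> H1"
  shows "(\<lambda>x. f x - g x) \<in> H1"
    and "\<exists>N. negligible N \<and> (\<forall>x\<in>Delta - N. dDelta (\<lambda>x. f x - g x) x = dDelta f x - dDelta g x)"
proof -
  obtain N1 where N1: "negligible N1"
    "\<And>x. x \<in> Delta - N1 \<Longrightarrow> -(pi/2) < x \<and> x < pi/2 \<and> (f has_real_derivative dDelta f x) (at x)"
    using H1_derivative[OF f] by metis
  obtain N2 where N2: "negligible N2"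
    "\<And>x. x \<in> Delta - N2 \<Longrightarrow> -(pi/2) < x \<and> x < pi/2 \<and> (g has_real_derivative dDelta g x) (at x)"
    using H1_derivative[OF g] by metis
  have N: "negligible (N1 \<union> N2)" using N1(1) N2(1) by simp
  have d: "-(pi/2) < x \<and> x < pi/2 \<and> ((\<lambda>x. f x - g x) has_real_derivative dDelta f x - dDelta g x) (at x)"
    if "x \<in> Delta - (N1 \<union> N2)" for x
    using N1(2)[of x] N2(2)[of x] that by (auto intro: DERIV_diff)
  have "abs_continuous_on Delta (\<lambda>x. f x - g x)"
    using f g by (intro abs_continuous_on_diff) (auto simp: H1_def)
  from H1I[OF this N d square_integrable_diff[OF H1_square_integrable[OF f] H1_square_integrable[OF g]]]
  show "(\<lambda>x. f x - g x) \<in> H1" by blast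
  show "\<exists>N. negligible N \<and> (\<forall>x\<in>Delta - N. dDelta (\<lambda>x. f x - g x) x = dDelta f x - dDelta g x)"
    using N d dDelta_eqI by blast
qed

text \<open>The single integration by parts behind the development, used with affine, cosine and
  constant weights. The bound on the derivative makes the weight Lipschitz, hence the product
  absolutely continuous.\<close>

lemma H1_product_FTC:
  assumes f: "f \<in> H1" and cd: "-(pi/2) \<le> c" "c \<le> d" "d \<le> pi/2"
    and \<phi>: "\<And>x. (\<phi> has_real_derivative \<phi>' x) (at x)" "\<And>x. \<bar>\<phi>' x\<bar> \<le> L"
  shows "((\<lambda>x. \<phi> x * dDelta f x + \<phi>' x * f x) has_integral \<phi> d * f d - \<phi> c * f c) {c..d}"
proof -
  have sub: "{c..d} \<subseteq> Delta" using cd by (auto simp: Delta_def)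
  have acf: "abs_continuous_on {c..d} f"
    using f sub by (auto simp: H1_def intro: abs_continuous_on_subset)
  have lip: "\<bar>\<phi> v - \<phi> u\<bar> \<le> L * \<bar>v - u\<bar>" for u v
    using field_differentiable_bound[of UNIV \<phi> \<phi>' L v u] \<phi> by simp
  have "L \<ge> 0" using \<phi>(2)[of 0] by linarith
  then have ac\<phi>: "abs_continuous_on {c..d} \<phi>"
    using lip by (intro abs_continuous_on_lipschitz) auto
  have bounded: "\<exists>B\<ge>0. \<forall>x\<in>{c..d}. \<bar>g x\<bar> \<le> B" if "abs_continuous_on {c..d} g" for g
  proof -
    have "compact (g ` {c..d})"
      by (intro compact_continuous_image abs_continuous_on_imp_continuous_on that) simp
    then obtain B where "\<forall>x\<in>{c..d}. \<bar>g x\<bar> \<le> B"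
      using compact_imp_bounded bounded_iff by (metis image_eqI real_norm_def)
    then show ?thesis by (intro exI[of _ "max 0 B"]) (auto simp: le_max_iff_disj)
  qed
  obtain A B where "A \<ge> 0" "\<forall>x\<in>{c..d}. \<bar>\<phi> x\<bar> \<le> A" "B \<ge> 0" "\<forall>x\<in>{c..d}. \<bar>f x\<bar> \<le> B"
    using bounded[OF ac\<phi>] bounded[OF acf] by auto
  then have ac: "abs_continuous_on {c..d} (\<lambda>x. \<phi> x * f x)"
    by (intro abs_continuous_on_mult[OF ac\<phi> acf, of A B]) auto
  obtain N where N: "negligible N"
    "\<And>x. x \<in> Delta - N \<Longrightarrow> -(pi/2) < x \<and> x < pi/2 \<and> (f has_real_derivative dDelta f x) (at x)"
    using H1_derivative[OF f] by metis
  show ?thesis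
  proof (rule abs_continuous_FTC[OF ac cd(2) N(1)])
    fix x assume "x \<in> {c..d} - N"
    then have "(f has_real_derivative dDelta f x) (at x)" using N(2) sub by blast
    then show "((\<lambda>x. \<phi> x * f x) has_real_derivative \<phi> x * dDelta f x + \<phi>' x * f x) (at x)"
      by (rule DERIV_mult'[OF \<phi>(1)])
  qed
qed

lemma H10_iff: "f \<in> H10 \<longleftrightarrow> f \<in> H1 \<and> f (-(pi/2)) = f (pi/2)"
  by (simp add: H10_def)

lemma H10_diff: "f \<in> H10 \<Longrightarrow> g \<in> H10 \<Longrightarrow> (\<lambda>x. f x - g x) \<in> H10"
  by (simp add: H10_iff H1_diff)

section \<open>Mean, energy and the Wirtinger inequality\<close>

definition mean :: "(real \<Rightarrow> real) \<Rightarrow> real" where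
  "mean f = integral Delta f / pi"

definition energy :: "(real \<Rightarrow> real) \<Rightarrow> real" where
  "energy f = integral Delta (\<lambda>x. (dDelta f x)\<^sup>2)"

lemma energy_nonneg: "f \<in> H1 \<Longrightarrow> 0 \<le> energy f"
  unfolding energy_def by (rule Henstock_Kurzweil_Integration.integral_nonneg) (auto simp: H1_def)

lemma mean_diff: "f \<in> H1 \<Longrightarrow> g \<in> H1 \<Longrightarrow> mean (\<lambda>x. f x - g x) = mean f - mean g"
  by (simp add: mean_def H1_integrable diff_divide_distrib Henstock_Kurzweil_Integration.integral_diff)

lemma energy_diff:
  assumes "f \<in> H1" "g \<in> H1"
  shows "energy (\<lambda>x. f x - g x) = (\<integral>x. (dDelta f x - dDelta g x)\<^sup>2 \<partial>lebesgue_on Delta)"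
proof -
  obtain N where N: "negligible N" "\<forall>x\<in>Delta - N. dDelta (\<lambda>x. f x - g x) x = dDelta f x - dDelta g x"
    using H1_diff(2)[OF assms] by blast
  have "energy (\<lambda>x. f x - g x) = integral Delta (\<lambda>x. (dDelta f x - dDelta g x)\<^sup>2)"
    unfolding energy_def by (rule integral_spike[OF N(1)]) (use N(2) in simp)
  also have "\<dots> = (\<integral>x. (dDelta f x - dDelta g x)\<^sup>2 \<partial>lebesgue_on Delta)"
    using square_integrable_diff[OF assms[THEN H1_square_integrable]]
    by (intro lebesgue_integral_eq_integral[symmetric]) (auto simp: square_integrable_def)
  finally show ?thesis .
qed

text \<open>
  If f takes equal values at both ends, then f x - mean f is the integral of w f', where w is the
  sawtooth t / pi - x / pi + 1/2 for t < x and t / pi - x / pi - 1/2 for t > x, and the integral of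
  w^2 is pi / 12. The bound below comes from the nonnegativity of the integral of (z w - f')^2 for
  the optimal z; since pi^2 < 12 it gives a Wirtinger inequality with constant below 1. The lemma
  expands this integral on an interval where w is affine.
\<close>

lemma H1_affine_piece:
  assumes f: "f \<in> H1" and cd: "-(pi/2) \<le> c" "c \<le> d" "d \<le> pi/2"
  shows "0 \<le> z\<^sup>2 * (pi / 3 * (d / pi + k)^3 - pi / 3 * (c / pi + k)^3)
     - 2 * z * ((d / pi + k) * f d - (c / pi + k) * f c - integral {c..d} f / pi)
     + integral {c..d} (\<lambda>x. (dDelta f x)\<^sup>2)"
proof -
  have sub: "{c..d} \<subseteq> Delta" using cd by (auto simp: Delta_def)
  have intf: "f integrable_on {c..d}" and intd: "(\<lambda>x. (dDelta f x)\<^sup>2) integrable_on {c..d}"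
    using sub f integrable_subinterval_real[of _ "-(pi/2)" "pi/2" c d] H1_integrable[OF f]
    by (auto simp: Delta_def H1_def)
  have "((\<lambda>x. (x / pi + k) * dDelta f x + 1 / pi * f x) has_integral (d / pi + k) * f d - (c / pi + k) * f c) {c..d}"
    by (rule H1_product_FTC[OF f cd, of "\<lambda>x. x / pi + k" "\<lambda>_. 1 / pi" "1 / pi"])
       (auto intro!: derivative_eq_intros)
  from has_integral_diff[OF this has_integral_mult_right[OF integrable_integral[OF intf], of "1 / pi"]]
  have 1: "((\<lambda>x. (x / pi + k) * dDelta f x) has_integral
     (d / pi + k) * f d - (c / pi + k) * f c - integral {c..d} f / pi) {c..d}" by simp
  have 2: "((\<lambda>x. (x / pi + k)\<^sup>2) has_integral pi / 3 * (d / pi + k)^3 - pi / 3 * (c / pi + k)^3) {c..d}"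
    by (rule fundamental_theorem_of_calculus[OF cd(2)])
       (auto simp: has_real_derivative_iff_has_vector_derivative[symmetric] intro!: derivative_eq_intros)
  have "((\<lambda>x. z\<^sup>2 * (x / pi + k)\<^sup>2 - 2 * z * ((x / pi + k) * dDelta f x) + (dDelta f x)\<^sup>2) has_integral
     z\<^sup>2 * (pi / 3 * (d / pi + k)^3 - pi / 3 * (c / pi + k)^3)
     - 2 * z * ((d / pi + k) * f d - (c / pi + k) * f c - integral {c..d} f / pi)
     + integral {c..d} (\<lambda>x. (dDelta f x)\<^sup>2)) {c..d}"
    by (intro has_integral_add has_integral_diff has_integral_mult_right 1 2 integrable_integral[OF intd])
  then show ?thesis
  proof (rule has_integral_nonneg)
    fix x
    have "0 \<le> (z * (x / pi + k) - dDelta f x)\<^sup>2" by simp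
    also have "\<dots> = z\<^sup>2 * (x / pi + k)\<^sup>2 - 2 * z * ((x / pi + k) * dDelta f x) + (dDelta f x)\<^sup>2"
      by (simp add: power2_diff power_mult_distrib mult.assoc)
    finally show "0 \<le> z\<^sup>2 * (x / pi + k)\<^sup>2 - 2 * z * ((x / pi + k) * dDelta f x) + (dDelta f x)\<^sup>2" .
  qed
qed

lemma H10_pointwise_bound:
  assumes f: "f \<in> H10" and x: "x \<in> Delta"
  shows "(f x - mean f)\<^sup>2 \<le> pi / 12 * energy f"
proof -
  let ?a = "-(pi/2)" and ?b = "pi/2"
  have fH: "f \<in> H1" and per: "f ?a = f ?b" using f by (auto simp: H10_iff)
  have ab: "?a \<le> x" "x \<le> ?b" using x by (auto simp: Delta_def)
  \<comment> \<open>This value minimises the quadratic z^2 (pi / 12) - 2 z (f x - mean f) + energy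
    f.\<close>
  define z where "z = 12 / pi * (f x - mean f)"
  define s where "s = x / pi"
  have comb: "integral {?a..x} g + integral {x..?b} g = integral Delta g" if "g integrable_on Delta" for g :: "real \<Rightarrow> real"
    unfolding Delta_def using ab that by (intro Henstock_Kurzweil_Integration.integral_combine) (auto simp: Delta_def)
  \<comment> \<open>The shifts 1/2 - s and -1/2 - s give the sawtooth the one-sided values 1/2 and
    -1/2 at x and the common value -s at both ends of Delta. The end terms then cancel because f
    agrees there.\<close>
  have 1: "0 \<le> z\<^sup>2 * (pi / 3 * (1/2)^3 - pi / 3 * (- s)^3)
     - 2 * z * (1/2 * f x - (- s) * f ?a - integral {?a..x} f / pi)
     + integral {?a..x} (\<lambda>x. (dDelta f x)\<^sup>2)"
    using H1_affine_piece[OF fH order.refl ab, of z "1/2 - s"] by (simp add: s_def)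
  have 2: "0 \<le> z\<^sup>2 * (pi / 3 * (- s)^3 - pi / 3 * (- 1/2)^3)
     - 2 * z * ((- s) * f ?b - (- 1/2) * f x - integral {x..?b} f / pi)
     + integral {x..?b} (\<lambda>x. (dDelta f x)\<^sup>2)"
    using H1_affine_piece[OF fH ab order.refl, of z "-1/2 - s"] by (simp add: s_def)
  have e: "integral {?a..x} (\<lambda>x. (dDelta f x)\<^sup>2) + integral {x..?b} (\<lambda>x. (dDelta f x)\<^sup>2) = energy f"
    using comb[of "\<lambda>x. (dDelta f x)\<^sup>2"] fH by (simp add: energy_def H1_def)
  have m: "integral {?a..x} f / pi + integral {x..?b} f / pi = mean f"
    using comb[OF H1_integrable[OF fH]] by (simp add: mean_def add_divide_distrib[symmetric])
  have "0 \<le> z\<^sup>2 * (pi / 3 * (1/2)^3 - pi / 3 * (- 1/2)^3)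
     - 2 * z * (f x - (integral {?a..x} f / pi + integral {x..?b} f / pi))
     + (integral {?a..x} (\<lambda>x. (dDelta f x)\<^sup>2) + integral {x..?b} (\<lambda>x. (dDelta f x)\<^sup>2))"
    using add_mono[OF 1 2] unfolding per by (simp add: algebra_simps)
  then have "0 \<le> z\<^sup>2 * (pi / 12) - 2 * z * (f x - mean f) + energy f"
    unfolding e m by (simp add: power3_eq_cube)
  also have "z\<^sup>2 * (pi / 12) - 2 * z * (f x - mean f) = - (12 / pi * (f x - mean f)\<^sup>2)"
    by (simp add: z_def power2_eq_square field_simps)
  finally show ?thesis by (simp add: field_simps)
qed

text \<open>Otherwise 8/15 <= pi/6 and sin (8/15) <= 1/2, whereas x - x^3/6 already exceeds 1/2 at x
  = 8/15. The bound is sharp enough to give pi^2 < 12.\<close>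

lemma pi_less_16_5: "pi < 16/5"
proof (rule ccontr)
  assume "\<not> pi < 16/5"
  then have "sin (8/15) \<le> sin (pi/6)"
    by (intro sin_monotone_2pi_le) auto
  moreover have "\<bar>sin (8/15) - (\<Sum>m<3. sin_coeff m * (8/15)^m)\<bar> \<le> inverse (fact 3) * \<bar>8/15::real\<bar>^3"
    by (rule Maclaurin_sin_bound)
  ultimately show False
    by (simp add: sin_30 sin_coeff_def eval_nat_numeral)
qed

text \<open>The identity is m^2 + (E - S) / pi, and integrating the pointwise bound over Delta gives
  S <= pi^2/12 E. The upper estimate drops S and uses pi >= 1.\<close>

lemma inner_i_self:
  assumes "f \<in> H10"
  shows "(mean f)\<^sup>2 + energy f / 40 \<le> inner_i f f" "inner_i f f \<le> (mean f)\<^sup>2 + energy f"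
proof -
  have fH: "f \<in> H1" using assms by (simp add: H10_iff)
  define S where "S = integral Delta (\<lambda>x. (f x - mean f)\<^sup>2)"
  have intS: "(\<lambda>x. (f x - mean f)\<^sup>2) integrable_on Delta"
    using integrable_continuous_real[of "-(pi/2)" "pi/2" "\<lambda>x. (f x - mean f)\<^sup>2"] H1_continuous_on[OF fH]
    by (simp add: Delta_def continuous_on_power continuous_on_diff)
  have "S \<ge> 0" unfolding S_def by (rule Henstock_Kurzweil_Integration.integral_nonneg[OF intS]) simp
  have E: "energy f \<ge> 0" by (rule energy_nonneg[OF fH])
  have const: "((\<lambda>_. c) has_integral pi * c) Delta" for c :: real
    using has_integral_const_real[of c "-(pi/2)" "pi/2"] by (simp add: Delta_def)
  have "S \<le> pi * (pi / 12 * energy f)"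
    using H10_pointwise_bound[OF assms]
    by (intro has_integral_le[OF integrable_integral[OF intS, folded S_def] const]) auto
  have f_int: "(f has_integral pi * mean f) Delta"
    using integrable_integral[OF H1_integrable[OF fH]] by (simp add: mean_def)
  have "((\<lambda>x. (f x - mean f)\<^sup>2 + 2 * mean f * f x - (mean f)\<^sup>2) has_integral
      S + 2 * mean f * (pi * mean f) - pi * (mean f)\<^sup>2) Delta"
    unfolding S_def by (intro has_integral_add has_integral_diff has_integral_mult_right const f_int integrable_integral[OF intS])
  then have "((\<lambda>x. (f x)\<^sup>2) has_integral S + pi * (mean f)\<^sup>2) Delta"
    by (simp add: power2_eq_square algebra_simps)
  from has_integral_diff[OF this integrable_integral, of "\<lambda>x. (dDelta f x)\<^sup>2"]
  have ff: "integral Delta (\<lambda>x. f x * f x - dDelta f x * dDelta f x) = S + pi * (mean f)\<^sup>2 - energy f"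
    using fH by (intro integral_unique) (simp add: H1_def energy_def power2_eq_square)
  then have eq: "inner_i f f = (mean f)\<^sup>2 + (energy f - S) / pi"
    unfolding inner_i_def ff integral_unique[OF f_int] by (simp add: power2_eq_square field_simps)
  \<comment> \<open>The claim amounts to pi/40 + pi^2/12 <= 1; with 16/5 for pi the left side is
    14/15. The constant 40 is a convenient choice, not an optimal one.\<close>
  have "pi * pi \<le> (16/5) * (16/5)" using pi_less_16_5 by (intro mult_mono) auto
  then have "pi * pi / 12 * energy f \<le> (16/5) * (16/5) / 12 * energy f"
    using E by (intro mult_right_mono) auto
  moreover have "pi * energy f \<le> 16/5 * energy f" using pi_less_16_5 E by (intro mult_right_mono) auto
  ultimately have "pi * energy f / 40 \<le> energy f - S"
    using \<open>S \<le> pi * (pi / 12 * energy f)\<close> E by simp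
  then show "(mean f)\<^sup>2 + energy f / 40 \<le> inner_i f f"
    unfolding eq by (simp add: field_simps)
  have "(energy f - S) / pi \<le> energy f / 1"
    using \<open>S \<ge> 0\<close> E pi_ge_two by (intro frac_le) auto
  then show "inner_i f f \<le> (mean f)\<^sup>2 + energy f" unfolding eq by simp
qed

section \<open>The reproducing kernel and completeness\<close>

lemma square_integrable_bounded_Delta:
  assumes g: "g \<in> borel_measurable borel" and "\<And>x. \<bar>g x\<bar> \<le> B"
  shows "square_integrable (lebesgue_on Delta) g"
proof -
  have "g \<in> borel_measurable lborel" using g by simp
  then have m: "g \<in> borel_measurable (lebesgue_on Delta)"
    by (intro measurable_restrict_space1 measurable_completion)
  have "(g x)\<^sup>2 \<le> B\<^sup>2" for x
    using power_mono[OF assms(2)[of x], of 2] by simp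
  then have "integrable (lebesgue_on Delta) (\<lambda>x. (g x)\<^sup>2)"
    using m by (intro finite_measure.integrable_const_bound[OF finite_measure_Delta, of _ "B\<^sup>2"]) auto
  then show ?thesis using m by (simp add: square_integrable_def)
qed

lemma K_i_has_real_derivative:
  assumes "x \<noteq> y"
  shows "((\<lambda>x. K_i x y) has_real_derivative - (pi/2) * (sgn (x - y) * cos (x - y))) (at x)"
proof (cases "x < y")
  case True
  have eq: "2 + (pi/2) * sin (u - y) = K_i u y" if "u \<in> {..<y}" for u
    using that sin_minus[of "u - y"] by (simp add: K_i_def del: sin_minus)
  have "((\<lambda>x. 2 + (pi/2) * sin (x - y)) has_real_derivative (pi/2) * cos (x - y)) (at x)"
    by (auto intro!: derivative_eq_intros)
  then have "((\<lambda>x. K_i x y) has_real_derivative (pi/2) * cos (x - y)) (at x)"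
    by (rule has_field_derivative_transform_within_open[where S = "{..<y}"]) (use True eq in auto)
  then show ?thesis using True by simp
next
  case False
  have eq: "2 - (pi/2) * sin (u - y) = K_i u y" if "u \<in> {y<..}" for u
    using that by (simp add: K_i_def)
  have "((\<lambda>x. 2 - (pi/2) * sin (x - y)) has_real_derivative - ((pi/2) * cos (x - y))) (at x)"
    by (auto intro!: derivative_eq_intros)
  then have "((\<lambda>x. K_i x y) has_real_derivative - ((pi/2) * cos (x - y))) (at x)"
    by (rule has_field_derivative_transform_within_open[where S = "{y<..}"]) (use False assms eq in auto)
  then show ?thesis using False assms by simp
qed

lemma cos_endpoint_diff:
  "cos (- (pi/2) - y) = - sin y" "cos (pi/2 - y) = sin y"
  by (simp_all add: cos_diff)

lemma K_i_in_H10: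
  assumes "y \<in> Delta"
  shows "(\<lambda>x. K_i x y) \<in> H10"
proof -
  let ?g = "\<lambda>x. - (pi/2) * (sgn (x - y) * cos (x - y))"
  have y: "-(pi/2) \<le> y" "y \<le> pi/2" using assms by (auto simp: Delta_def)
  have sin_lip: "\<bar>sin p - sin q\<bar> \<le> \<bar>p - q\<bar>" for p q :: real
    using field_differentiable_bound[of UNIV sin cos 1 p q] by (auto intro: DERIV_sin[THEN DERIV_subset])
  have "\<bar>sin \<bar>v - y\<bar> - sin \<bar>u - y\<bar>\<bar> \<le> \<bar>v - u\<bar>" for u v
    using sin_lip[of "\<bar>v - y\<bar>" "\<bar>u - y\<bar>"] abs_triangle_ineq3[of "v - y" "u - y"] by simp
  then have "\<bar>- (pi/2) * (sin \<bar>v - y\<bar> - sin \<bar>u - y\<bar>)\<bar> \<le> pi/2 * \<bar>v - u\<bar>" for u v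
    unfolding abs_mult by (intro mult_mono) auto
  then have "\<bar>K_i v y - K_i u y\<bar> \<le> pi/2 * \<bar>v - u\<bar>" for u v
    by (simp add: K_i_def algebra_simps)
  then have ac: "abs_continuous_on Delta (\<lambda>x. K_i x y)"
    by (intro abs_continuous_on_lipschitz[of "pi/2"]) auto
  have sq: "square_integrable (lebesgue_on Delta) ?g"
  proof (rule square_integrable_bounded_Delta)
    show "\<bar>?g x\<bar> \<le> pi/2" for x
    proof -
      have "\<bar>sgn (x - y) * cos (x - y)\<bar> \<le> 1 * 1" unfolding abs_mult
        by (intro mult_mono abs_cos_le_one) (auto simp: sgn_real_def)
      then show ?thesis by (simp add: abs_mult)
    qed
  qed measurable
  have "(\<lambda>x. K_i x y) \<in> H1"
    \<comment> \<open>The exceptional points are the two ends and the kink at y.\<close>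
    by (rule H1I[OF ac _ _ sq, of "{-(pi/2), pi/2, y}"])
       (use K_i_has_real_derivative in \<open>auto simp: Delta_def\<close>)
  moreover have "K_i (-(pi/2)) y = K_i (pi/2) y"
  proof -
    \<comment> \<open>For y in Delta the distances to the two ends add up to pi, so their sines
      agree.\<close>
    have "sin \<bar>-(pi/2) - y\<bar> = cos y" using y sin_add[of y "pi/2"] by (simp add: add.commute)
    moreover have "sin \<bar>pi/2 - y\<bar> = cos y" using y by (simp add: sin_diff)
    ultimately show ?thesis by (simp add: K_i_def)
  qed
  ultimately show ?thesis by (simp add: H10_iff)
qed

text \<open>That the value does not depend on y is essential: it lets the product of integrals in
  \<open>inner_i\<close> cancel the term coming from the constant 2 in the kernel.\<close>

lemma integral_K_i:
  assumes "y \<in> Delta"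
  shows "integral Delta (\<lambda>x. K_i x y) = pi"
proof -
  have y: "-(pi/2) \<le> y" "y \<le> pi/2" using assms by (auto simp: Delta_def)
  have "((\<lambda>x. 2 + pi/2 * sin (x - y)) has_integral
      (2 * y - pi/2 * cos (y - y)) - (2 * (-(pi/2)) - pi/2 * cos (-(pi/2) - y))) {-(pi/2)..y}"
    by (rule fundamental_theorem_of_calculus[OF y(1)])
       (auto simp: has_real_derivative_iff_has_vector_derivative[symmetric] intro!: derivative_eq_intros)
  moreover have "2 + pi/2 * sin (x - y) = K_i x y" if "x \<in> {-(pi/2)..y}" for x
    using that sin_minus[of "x - y"] by (simp add: K_i_def del: sin_minus)
  ultimately have 1: "((\<lambda>x. K_i x y) has_integral
      (2 * y - pi/2 * cos (y - y)) - (2 * (-(pi/2)) - pi/2 * cos (-(pi/2) - y))) {-(pi/2)..y}"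
    by (rule has_integral_eq[rotated])
  have "((\<lambda>x. 2 - pi/2 * sin (x - y)) has_integral
      (2 * (pi/2) + pi/2 * cos (pi/2 - y)) - (2 * y + pi/2 * cos (y - y))) {y..pi/2}"
    by (rule fundamental_theorem_of_calculus[OF y(2)])
       (auto simp: has_real_derivative_iff_has_vector_derivative[symmetric] intro!: derivative_eq_intros)
  moreover have "2 - pi/2 * sin (x - y) = K_i x y" if "x \<in> {y..pi/2}" for x
    using that by (simp add: K_i_def)
  ultimately have 2: "((\<lambda>x. K_i x y) has_integral
      (2 * (pi/2) + pi/2 * cos (pi/2 - y)) - (2 * y + pi/2 * cos (y - y))) {y..pi/2}"
    by (rule has_integral_eq[rotated])
  show ?thesis
    using has_integral_combine[OF y 1 2] unfolding Delta_def cos_endpoint_diff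
    by (intro integral_unique) simp
qed

text \<open>On either side of y the integrand f K - f' K' equals 2 f plus or minus pi/2 times the
  derivative of cos(x - y) f(x). The two contributions at y add up to -pi f(y), and those at the
  ends of Delta cancel since f takes the same value there.\<close>

lemma K_i_reproducing:
  assumes y: "y \<in> Delta" and f: "f \<in> H10"
  shows "inner_i f (\<lambda>x. K_i x y) = f y"
proof -
  let ?a = "-(pi/2)" and ?b = "pi/2"
  let ?k = "\<lambda>x. f x * K_i x y - dDelta f x * dDelta (\<lambda>x. K_i x y) x"
  have fH: "f \<in> H1" and per: "f ?a = f ?b" using f by (auto simp: H10_iff)
  have ab: "?a \<le> y" "y \<le> ?b" using y by (auto simp: Delta_def)
  have intf: "f integrable_on {?a..?b}" using H1_integrable[OF fH] by (simp add: Delta_def)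
  have comb: "integral {?a..y} f + integral {y..?b} f = integral Delta f"
    unfolding Delta_def using ab intf by (intro Henstock_Kurzweil_Integration.integral_combine) auto
  have ftc: "((\<lambda>x. cos (x - y) * dDelta f x + - sin (x - y) * f x) has_integral
      cos (d - y) * f d - cos (c - y) * f c) {c..d}" if "?a \<le> c" "c \<le> d" "d \<le> ?b" for c d
    by (rule H1_product_FTC[OF fH that, of _ _ 1]) (auto intro!: derivative_eq_intros)
  have part: "(f has_integral integral {c..d} f) {c..d}" if "?a \<le> c" "d \<le> ?b" for c d
    using that by (intro integrable_integral integrable_subinterval_real[OF intf]) auto
  have dK: "dDelta (\<lambda>x. K_i x y) x = - (pi/2) * (sgn (x - y) * cos (x - y))"
    if "x \<in> Delta - {?a, ?b, y}" for x
    using that by (intro dDelta_eqI K_i_has_real_derivative) (auto simp: Delta_def)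
  have "((\<lambda>x. 2 * f x - pi/2 * (cos (x - y) * dDelta f x + - sin (x - y) * f x)) has_integral
      2 * integral {?a..y} f - pi/2 * (cos (y - y) * f y - cos (?a - y) * f ?a)) {?a..y}"
    using ab by (intro has_integral_diff has_integral_mult_right ftc part) auto
  then have 1: "(?k has_integral 2 * integral {?a..y} f - pi/2 * (cos (y - y) * f y - cos (?a - y) * f ?a)) {?a..y}"
  proof (rule has_integral_spike[rotated 2])
    show "negligible {?a, ?b, y}" by simp
    fix x assume "x \<in> {?a..y} - {?a, ?b, y}"
    then have x: "x \<in> Delta - {?a, ?b, y}" "x < y" using ab by (auto simp: Delta_def)
    moreover from this have "sin \<bar>x - y\<bar> = - sin (x - y)"
      using sin_minus[of "x - y"] by (simp add: abs_if del: sin_minus)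
    ultimately show "?k x = 2 * f x - pi/2 * (cos (x - y) * dDelta f x + - sin (x - y) * f x)"
      unfolding dK[OF x(1)] by (simp add: K_i_def algebra_simps)
  qed
  have "((\<lambda>x. 2 * f x + pi/2 * (cos (x - y) * dDelta f x + - sin (x - y) * f x)) has_integral
      2 * integral {y..?b} f + pi/2 * (cos (?b - y) * f ?b - cos (y - y) * f y)) {y..?b}"
    using ab by (intro has_integral_add has_integral_mult_right ftc part) auto
  then have 2: "(?k has_integral 2 * integral {y..?b} f + pi/2 * (cos (?b - y) * f ?b - cos (y - y) * f y)) {y..?b}"
  proof (rule has_integral_spike[rotated 2])
    show "negligible {?a, ?b, y}" by simp
    fix x assume "x \<in> {y..?b} - {?a, ?b, y}"
    then have x: "x \<in> Delta - {?a, ?b, y}" "x > y" using ab by (auto simp: Delta_def)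
    then show "?k x = 2 * f x + pi/2 * (cos (x - y) * dDelta f x + - sin (x - y) * f x)"
      unfolding dK[OF x(1)] by (simp add: K_i_def algebra_simps)
  qed
  have "integral Delta ?k = 2 * integral {?a..y} f - pi/2 * (cos (y - y) * f y - cos (?a - y) * f ?a)
     + (2 * integral {y..?b} f + pi/2 * (cos (?b - y) * f ?b - cos (y - y) * f y))"
    unfolding Delta_def by (rule integral_unique[OF has_integral_combine[OF ab 1 2]])
  also have "\<dots> = 2 * (integral {?a..y} f + integral {y..?b} f) - pi * f y"
    unfolding cos_endpoint_diff per by (simp add: algebra_simps)
  finally have k: "integral Delta ?k = 2 * integral Delta f - pi * f y" unfolding comb .
  show ?thesis
    unfolding inner_i_def integral_K_i[OF y] k by (simp add: power2_eq_square field_simps)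
qed

lemma norm_i_bounds:
  assumes "f \<in> H10"
  shows "(mean f)\<^sup>2 \<le> (norm_i f)\<^sup>2" "energy f \<le> 40 * (norm_i f)\<^sup>2" "norm_i f \<ge> 0"
    "(norm_i f)\<^sup>2 \<le> (mean f)\<^sup>2 + energy f"
proof -
  have E: "energy f \<ge> 0" using assms by (intro energy_nonneg) (simp add: H10_iff)
  have m: "(mean f)\<^sup>2 \<ge> 0" by simp
  note b = inner_i_self[OF assms]
  have "inner_i f f \<ge> 0" using b(1) E m by linarith
  then have "(norm_i f)\<^sup>2 = inner_i f f" "norm_i f \<ge> 0" by (simp_all add: norm_i_def)
  then show "(mean f)\<^sup>2 \<le> (norm_i f)\<^sup>2" "energy f \<le> 40 * (norm_i f)\<^sup>2" "norm_i f \<ge> 0"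
    "(norm_i f)\<^sup>2 \<le> (mean f)\<^sup>2 + energy f"
    using b E m by linarith+
qed

text \<open>The constant is 1 + 4: the mean is at most the norm, and the squared deviation from it
  is at most (16/5)/12 * 40 < 16 times the squared norm.\<close>

lemma H10_evaluation_bound:
  assumes f: "f \<in> H10" and x: "x \<in> Delta"
  shows "\<bar>f x\<bar> \<le> 5 * norm_i f"
proof -
  note b = norm_i_bounds[OF f]
  have m: "\<bar>mean f\<bar> \<le> norm_i f" using b(1,3) abs_le_square_iff[of "mean f" "norm_i f"] by simp
  have "(f x - mean f)\<^sup>2 \<le> pi / 12 * energy f" by (rule H10_pointwise_bound[OF f x])
  also have "\<dots> \<le> (16/5) / 12 * (40 * (norm_i f)\<^sup>2)"
    using pi_less_16_5 b(2) energy_nonneg[of f] f by (intro mult_mono) (auto simp: H10_iff)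
  also have "\<dots> \<le> (4 * norm_i f)\<^sup>2" by (simp add: power_mult_distrib)
  finally have "\<bar>f x - mean f\<bar> \<le> \<bar>4 * norm_i f\<bar>" by (simp only: abs_le_square_iff)
  then show ?thesis using m b(3) by linarith
qed

section \<open>Completeness\<close>

lemma H1_antiderivative:
  fixes h :: "real \<Rightarrow> real" and c :: real
  assumes h: "square_integrable (lebesgue_on Delta) h"
  defines "f \<equiv> \<lambda>x. integral {-(pi/2)..x} (\<lambda>t. if t \<in> Delta then h t else 0) - c"
  shows "f \<in> H1" "\<exists>N. negligible N \<and> (\<forall>x\<in>Delta - N. dDelta f x = h x)"
    "f (-(pi/2)) = - c" "f (pi/2) = integral Delta h - c"
proof -
  \<comment> \<open>Extension by zero makes h integrable over every interval of the line, as
    \<open>indefinite_integral_has_derivative_AE\<close> demands.\<close>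
  let ?h = "\<lambda>t. if t \<in> Delta then h t else 0"
  have "h integrable_on Delta" by (rule square_integrable_integrable_on_Delta[OF h])
  then have "?h integrable_on UNIV" by (simp add: integrable_restrict_UNIV)
  then have int: "?h integrable_on {c..d}" for c d
    using integrable_on_subinterval by blast
  obtain N where N: "negligible N"
    "\<And>a x. x \<notin> N \<Longrightarrow> a < x \<Longrightarrow> ((\<lambda>u. integral {a..u} ?h) has_real_derivative ?h x) (at x)"
    using indefinite_integral_has_derivative_AE[OF int] by metis
  let ?N = "N \<union> {-(pi/2), pi/2}"
  have N': "negligible ?N" using N(1) by simp
  have d: "-(pi/2) < x \<and> x < pi/2 \<and> (f has_real_derivative h x) (at x)" if "x \<in> Delta - ?N" for x
  proof -
    have "-(pi/2) < x" "x < pi/2" "x \<in> Delta" "x \<notin> N" using that by (auto simp: Delta_def)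
    then show ?thesis
      using DERIV_diff[OF N(2)[of x "-(pi/2)"] DERIV_const[of c]] by (simp add: f_def)
  qed
  have "(\<lambda>x. (h x)\<^sup>2) integrable_on Delta"
    using h by (simp add: square_integrable_Delta_iff)
  then have "(\<lambda>x. (?h x)\<^sup>2) integrable_on Delta"
    by (rule integrable_eq) simp
  then have "abs_continuous_on Delta (\<lambda>x. integral {-(pi/2)..x} ?h)"
    using int[of "-(pi/2)" "pi/2", folded Delta_def]
    by (intro abs_continuous_on_integral_square[of ?h "-(pi/2)" "pi/2", folded Delta_def])
  then have "abs_continuous_on Delta f"
    unfolding f_def by (rule abs_continuous_on_diff) (rule abs_continuous_on_lipschitz[of 0], auto)
  then show "f \<in> H1" using H1I[OF _ N' d h] by blast
  show "\<exists>N. negligible N \<and> (\<forall>x\<in>Delta - N. dDelta f x = h x)"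
    using N' d dDelta_eqI by blast
  show "f (-(pi/2)) = - c" by (simp add: f_def)
  have "integral Delta ?h = integral Delta h" by (rule integral_cong) simp
  then show "f (pi/2) = integral Delta h - c" by (simp add: f_def Delta_def)
qed

text \<open>Cauchy-Schwarz against the constant 1, obtained by integrating the square of pi g - I
  over Delta, whose length is pi.\<close>

lemma integral_square_le_Delta:
  assumes g: "square_integrable (lebesgue_on Delta) g"
  shows "(integral Delta g)\<^sup>2 \<le> pi * (\<integral>x. (g x)\<^sup>2 \<partial>lebesgue_on Delta)"
proof -
  define I where "I = integral Delta g"
  define S where "S = integral Delta (\<lambda>x. (g x)\<^sup>2)"
  have 1: "(g has_integral I) Delta"
    unfolding I_def using square_integrable_integrable_on_Delta[OF g] by (rule integrable_integral)
  have 2: "((\<lambda>x. (g x)\<^sup>2) has_integral S) Delta"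
    unfolding S_def using g by (intro integrable_integral) (simp add: square_integrable_Delta_iff)
  have 3: "((\<lambda>_. I\<^sup>2) has_integral pi * I\<^sup>2) Delta"
    using has_integral_const_real[of "I\<^sup>2" "-(pi/2)" "pi/2"] by (simp add: Delta_def)
  have "((\<lambda>x. pi\<^sup>2 * (g x)\<^sup>2 - (2 * pi * I) * g x + I\<^sup>2) has_integral pi\<^sup>2 * S - (2 * pi * I) * I + pi * I\<^sup>2) Delta"
    by (intro has_integral_add has_integral_diff has_integral_mult_right 1 2 3)
  then have "0 \<le> pi\<^sup>2 * S - (2 * pi * I) * I + pi * I\<^sup>2"
  proof (rule has_integral_nonneg)
    fix x
    have "0 \<le> (pi * g x - I)\<^sup>2" by simp
    then show "0 \<le> pi\<^sup>2 * (g x)\<^sup>2 - (2 * pi * I) * g x + I\<^sup>2"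
      by (simp add: power2_diff power_mult_distrib mult_ac)
  qed
  also have "\<dots> = pi * (pi * S - I\<^sup>2)" by (simp add: power2_eq_square algebra_simps)
  finally have "I\<^sup>2 \<le> pi * S"
    using mult_pos_neg[OF pi_gt_zero, of "pi * S - I\<^sup>2"] by linarith
  moreover have "S = (\<integral>x. (g x)\<^sup>2 \<partial>lebesgue_on Delta)"
    unfolding S_def using g by (intro lebesgue_integral_eq_integral[symmetric]) (auto simp: square_integrable_def)
  ultimately show ?thesis by (simp add: I_def)
qed

text \<open>Derivatives converge in L^2 to some h and means to some \<mu>. The limit is the
  antiderivative of h with mean \<mu>; it lies in \<open>H10\<close> because the integral of h
  vanishes.\<close>

lemma H10_complete:
  fixes F :: "nat \<Rightarrow> real \<Rightarrow> real"
  assumes F: "\<And>n. F n \<in> H10"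
    and cauchy: "\<And>e. e > 0 \<Longrightarrow> \<exists>N. \<forall>m\<ge>N. \<forall>n\<ge>N. norm_i (\<lambda>x. F m x - F n x) < e"
  shows "\<exists>f\<in>H10. (\<lambda>n. norm_i (\<lambda>x. F n x - f x)) \<longlonglongrightarrow> 0"
proof -
  have FH: "F n \<in> H1" for n using F by (simp add: H10_iff)
  let ?M = "lebesgue_on Delta"
  have L2: "\<exists>N. \<forall>m\<ge>N. \<forall>n\<ge>N. (\<integral>x. (dDelta (F m) x - dDelta (F n) x)\<^sup>2 \<partial>?M) < e" if "e > 0" for e
  proof -
    obtain N where N: "\<And>m n. m \<ge> N \<Longrightarrow> n \<ge> N \<Longrightarrow> norm_i (\<lambda>x. F m x - F n x) < sqrt (e / 40)"
      using cauchy[of "sqrt (e / 40)"] \<open>e > 0\<close> by auto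
    have "(\<integral>x. (dDelta (F m) x - dDelta (F n) x)\<^sup>2 \<partial>?M) < e" if "m \<ge> N" "n \<ge> N" for m n
    proof -
      note b = norm_i_bounds[OF H10_diff[OF F[of m] F[of n]]]
      have "(norm_i (\<lambda>x. F m x - F n x))\<^sup>2 < (sqrt (e / 40))\<^sup>2"
        using N[OF that] b(3) by (intro power_strict_mono) auto
      then show ?thesis using b(2) \<open>e > 0\<close> by (simp add: energy_diff[OF FH FH])
    qed
    then show ?thesis by blast
  qed
  obtain h where h: "square_integrable ?M h"
    "(\<lambda>n. \<integral>x. (dDelta (F n) x - h x)\<^sup>2 \<partial>?M) \<longlonglongrightarrow> 0"
  proof (rule finite_measure.square_integrable_complete[OF finite_measure_Delta, of "\<lambda>n. dDelta (F n)"])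
    show "square_integrable ?M (dDelta (F n))" for n by (rule H1_square_integrable[OF FH])
  qed (rule L2)
  have "Cauchy (\<lambda>n. mean (F n))"
  proof (rule metric_CauchyI)
    fix e :: real assume "e > 0"
    then obtain N where N: "\<And>m n. m \<ge> N \<Longrightarrow> n \<ge> N \<Longrightarrow> norm_i (\<lambda>x. F m x - F n x) < e"
      using cauchy by blast
    have "dist (mean (F m)) (mean (F n)) < e" if "m \<ge> N" "n \<ge> N" for m n
    proof -
      note b = norm_i_bounds[OF H10_diff[OF F[of m] F[of n]]]
      have "\<bar>mean (F m) - mean (F n)\<bar> \<le> norm_i (\<lambda>x. F m x - F n x)"
        using b(1,3) abs_le_square_iff[of "mean (F m) - mean (F n)" "norm_i (\<lambda>x. F m x - F n x)"]
        by (simp add: mean_diff[OF FH FH])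
      then show ?thesis using N[OF that] by (simp add: dist_real_def)
    qed
    then show "\<exists>N. \<forall>m\<ge>N. \<forall>n\<ge>N. dist (mean (F m)) (mean (F n)) < e" by blast
  qed
  then obtain \<mu> where \<mu>: "(\<lambda>n. mean (F n)) \<longlonglongrightarrow> \<mu>"
    using Cauchy_convergent_iff convergent_def by blast
  have "integral Delta h = 0"
  proof -
    \<comment> \<open>The derivative of F n has integral 0 since F n agrees at both ends (constant
      weight 1 in \<open>H1_product_FTC\<close>). So the integral of h is minus that of the
      difference, which tends to 0 with its L^2 norm.\<close>
    have le: "(integral Delta h)\<^sup>2 \<le> pi * (\<integral>x. (dDelta (F n) x - h x)\<^sup>2 \<partial>?M)" for n
    proof -
      have "((\<lambda>x. 1 * dDelta (F n) x + 0 * F n x) has_integral 1 * F n (pi/2) - 1 * F n (-(pi/2))) {-(pi/2)..pi/2}"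
        by (rule H1_product_FTC[OF FH, of _ _ _ _ 0]) auto
      then have "(dDelta (F n) has_integral 0) Delta"
        using F[of n] by (simp add: Delta_def H10_iff)
      from has_integral_diff[OF this integrable_integral[OF square_integrable_integrable_on_Delta[OF h(1)]]]
      have "integral Delta (\<lambda>x. dDelta (F n) x - h x) = - integral Delta h"
        by (intro integral_unique) simp
      then show ?thesis
        using integral_square_le_Delta[OF square_integrable_diff[OF H1_square_integrable[OF FH[of n]] h(1)]] by simp
    qed
    have "(\<lambda>n. pi * (\<integral>x. (dDelta (F n) x - h x)\<^sup>2 \<partial>?M)) \<longlonglongrightarrow> pi * 0"
      by (intro tendsto_intros h(2))
    from LIMSEQ_le_const[OF this] have "(integral Delta h)\<^sup>2 \<le> pi * 0"
      using le by blast
    then show ?thesis by simp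
  qed
  note anti = H1_antiderivative[OF h(1)]
  \<comment> \<open>An auxiliary antiderivative whose mean fixes the constant to subtract: removing
    mean f0 - \<mu> leaves mean \<mu>.\<close>
  define f0 where "f0 = (\<lambda>x. integral {-(pi/2)..x} (\<lambda>t. if t \<in> Delta then h t else 0) - 0)"
  define f where "f = (\<lambda>x. integral {-(pi/2)..x} (\<lambda>t. if t \<in> Delta then h t else 0) - (mean f0 - \<mu>))"
  have fH: "f \<in> H1" and f0H: "f0 \<in> H1" unfolding f_def f0_def by (rule anti(1))+
  have f: "f \<in> H10"
    using fH anti(3,4)[of "mean f0 - \<mu>"] \<open>integral Delta h = 0\<close> by (simp add: H10_iff f_def)
  have "mean f = \<mu>"
  proof -
    have "((\<lambda>_. mean f0 - \<mu>) has_integral pi * (mean f0 - \<mu>)) Delta"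
      using has_integral_const_real[of "mean f0 - \<mu>" "-(pi/2)" "pi/2"] by (simp add: Delta_def)
    from has_integral_diff[OF integrable_integral[OF H1_integrable[OF f0H]] this]
    have "(f has_integral integral Delta f0 - pi * (mean f0 - \<mu>)) Delta"
      by (simp add: f_def f0_def)
    from integral_unique[OF this] show ?thesis by (simp add: mean_def field_simps)
  qed
  have energy: "energy (\<lambda>x. F n x - f x) = (\<integral>x. (dDelta (F n) x - h x)\<^sup>2 \<partial>?M)" for n
  proof -
    obtain N where N: "negligible N" "\<forall>x\<in>Delta - N. dDelta f x = h x"
      using anti(2)[of "mean f0 - \<mu>"] unfolding f_def by blast
    have "energy (\<lambda>x. F n x - f x) = integral Delta (\<lambda>x. (dDelta (F n) x - dDelta f x)\<^sup>2)"
      unfolding energy_diff[OF FH fH]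
      using square_integrable_diff[OF H1_square_integrable[OF FH[of n]] H1_square_integrable[OF fH]]
      by (intro lebesgue_integral_eq_integral) (auto simp: square_integrable_def)
    also have "\<dots> = integral Delta (\<lambda>x. (dDelta (F n) x - h x)\<^sup>2)"
      by (rule integral_spike[OF N(1)]) (use N(2) in simp)
    also have "\<dots> = (\<integral>x. (dDelta (F n) x - h x)\<^sup>2 \<partial>?M)"
      using square_integrable_diff[OF H1_square_integrable[OF FH[of n]] h(1)]
      by (intro lebesgue_integral_eq_integral[symmetric]) (auto simp: square_integrable_def)
    finally show ?thesis .
  qed
  have "(\<lambda>n. (norm_i (\<lambda>x. F n x - f x))\<^sup>2) \<longlonglongrightarrow> 0"
  proof (rule tendsto_sandwich[OF always_eventually always_eventually])
    show "\<forall>n. 0 \<le> (norm_i (\<lambda>x. F n x - f x))\<^sup>2" by simp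
    show "\<forall>n. (norm_i (\<lambda>x. F n x - f x))\<^sup>2 \<le> (mean (F n) - \<mu>)\<^sup>2 + (\<integral>x. (dDelta (F n) x - h x)\<^sup>2 \<partial>?M)"
      using norm_i_bounds(4)[OF H10_diff[OF F f]] by (simp add: mean_diff[OF FH fH] energy \<open>mean f = \<mu>\<close>)
    have "(\<lambda>n. (mean (F n) - \<mu>)\<^sup>2 + (\<integral>x. (dDelta (F n) x - h x)\<^sup>2 \<partial>?M)) \<longlonglongrightarrow> (\<mu> - \<mu>)\<^sup>2 + 0"
      by (intro tendsto_intros \<mu> h(2))
    then show "(\<lambda>n. (mean (F n) - \<mu>)\<^sup>2 + (\<integral>x. (dDelta (F n) x - h x)\<^sup>2 \<partial>?M)) \<longlonglongrightarrow> 0" by simp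
  qed simp
  from tendsto_real_sqrt[OF this] have "(\<lambda>n. norm_i (\<lambda>x. F n x - f x)) \<longlonglongrightarrow> 0"
    using norm_i_bounds(3)[OF H10_diff[OF F f]] by simp
  then show ?thesis using f by blast
qed

theorem theorem3p4:
  shows "(\<forall>F :: nat \<Rightarrow> real \<Rightarrow> real.
            (\<forall>n. F n \<in> H10) \<and>
            (\<forall>e>0. \<exists>N. \<forall>m\<ge>N. \<forall>n\<ge>N. norm_i (\<lambda>x. F m x - F n x) < e)
            \<longrightarrow> (\<exists>f\<in>H10. (\<lambda>n. norm_i (\<lambda>x. F n x - f x)) \<longlonglongrightarrow> 0))
       \<and> (\<forall>x\<in>Delta. \<exists>C. \<forall>f\<in>H10. \<bar>f x\<bar> \<le> C * norm_i f)
       \<and> (\<forall>y\<in>Delta. (\<lambda>x. K_i x y) \<in> H10 \<and>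
            (\<forall>f\<in>H10. inner_i f (\<lambda>x. K_i x y) = f y))"
  using H10_complete K_i_in_H10 K_i_reproducing by (auto intro!: exI[of _ 5] H10_evaluation_bound)

end
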